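(* Let $M=2^m$ and let $\Omega=[\mathbb{X}_{\mathrm{PSK}},\mathbb{L}_m,\mathbb{U}_M]$ where $\mathbb{X}_{\mathrm{PSK}}$ is the $M$-PSK input alphabet, the input distribution is uniform, and $\mathbb{L}_m$ is one of the labelings $\mathbb{G}_m$ ($m\ge1$), $\mathbb{N}_m$ ($m\ge1$), $\mathbb{S}_m$ ($m\ge3$), $\mathbb{F}_m$ ($m\ge2$). Then the first-order coefficient of the BICM capacity is $$\alpha^{\mathrm{BI}}_\Omega=\begin{cases}\dfrac{8\log_2 e}{M^2\sin^2(\pi/M)}, & \text{if }\mathbb{L}_m=\mathbb{G}_m,\\[2ex] \dfrac{4\log_2 e}{M^2\sin^2(\pi/M)}, & \text{if }\mathbb{L}_m=\mathbb{N}_m,\\[2ex] \dfrac{4\log_2 e}{M^2\sin^2(\pi/M)}\left[1+\bigl(1-\sec\tfrac{2\pi}{M}\bigr)^2\right], & \text{if }\mathbb{L}_m=\mathbb{S}_m,\\[2ex] \dfrac{4\log_2 e}{M^2\sin^2(\pi/M)}\left[1+\displaystyle\sum_{k=2}^{m}\tan^2(\pi/2^k)\right], & \text{if }\mathbb{L}_m=\mathbb{F}_m,\end{cases}$$ where $\sec x=1/\cos x$.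
   Context: $M$-PSK. The $M$-PSK input alphabet $\mathbb{X}_{\mathrm{PSK}}$ is the $M\times2$ matrix with rows $\boldsymbol{x}_i=\left[\cos\frac{(2i+1)\pi}{M},\sin\frac{(2i+1)\pi}{M}\right]$, $i=0,\ldots,M-1$ (dimension $N=2$). Labelings. A binary labeling of order $m$ is an $M\times m$ matrix whose rows $\boldsymbol{c}_i=[c_{i,0},\ldots,c_{i,m-1}]$, $i=0,\ldots,M-1$, are the $M$ distinct elements of $\{0,1\}^m$. The reflection of a labeling with rows $\boldsymbol{c}_0,\ldots,\boldsymbol{c}_{M-1}$ is the labeling of order $m+1$ obtained from the matrix with rows $\boldsymbol{c}_0,\ldots,\boldsymbol{c}_{M-1},\boldsymbol{c}_{M-1},\ldots,\boldsymbol{c}_0$ by adding an extra column on the left consisting of $M$ zeros followed by $M$ ones. - The binary reflected Gray code (BRGC) $\mathbb{G}_m$, $m\ge1$, is obtained from $[0,1]^{T}$ by $m-1$ recursive reflections. - The natural binary code (NBC) $\mathbb{N}_m$, $m\ge1$, has as row $\boldsymbol{c}_i$ the base-2 representation of $i$, most significant bit first. - The binary semi-Gray code (BSGC) $\mathbb{S}_m$, $m\ge3$, is obtained from $\mathbb{G}_m$ by replacing the first column by the modulo-2 sum of the first and last columns. - The folded binary code (FBC) $\mathbb{F}_m$, $m\ge2$, is one reflection of $\mathbb{N}_{m-1}$. Constellations. $\Omega=[\mathbb{X},\mathbb{L},\mathbb{U}_M]$, where $\mathbb{X}$ has rows $\boldsymbol{x}_0,\ldots,\boldsymbol{x}_{M-1}\in\mathbb{R}^N$,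 denotes the constellation in which the bits $C_0,\ldots,C_{m-1}$ are independent and uniform on $\{0,1\}$ and the transmitted symbol is $\boldsymbol{X}=\boldsymbol{x}_i$ when $[C_0,\ldots,C_{m-1}]=\boldsymbol{c}_i$. Put $E_s=\mathbb{E}[\|\boldsymbol{X}\|^2]$. Channel. $\boldsymbol{Y}=\boldsymbol{H}\circ\boldsymbol{X}+\boldsymbol{Z}$, where $\circ$ is the element-wise product, $\boldsymbol{X},\boldsymbol{H},\boldsymbol{Z}$ are mutually independent, $\boldsymbol{Z}$ is Gaussian in $\mathbb{R}^N$ with independent zero-mean components of variance $N_0/2$, and $\boldsymbol{H}$ is a real random vector whose $N$ components (possibly dependent) all have the same distribution, that of a random variable $H$, with $0<\mathbb{E}[H^2]<\infty$. It is assumed that there is $\omega>0$ such that $\Pr\{\|\boldsymbol{H}\|^2>\Delta\}\le\exp(-\Delta^\omega)$ for all sufficiently large $\Delta>0$. $\boldsymbol{H}$ and $N_0$ are known at the receiver. Define $\mathsf{SNR}=\mathbb{E}[H^2]\,E_s/N_0$; the constellation and the law of $\boldsymbol{H}$ are fixed and $N_0$ varies over $(0,\infty)$, so $\mathsf{SNR}\to0$ means $N_0\to\infty$. BICM capacity (in bits). $\mathsf{I}^{\mathrm{BI}}_\Omega(\mathsf{SNR})=\sum_{k=0}^{m-1}\mathbb{E}\left[\log_2\frac{p_{\boldsymbol{Y}|C_k,\boldsymbol{H}}(\boldsymbol{Y})}{p_{\boldsymbol{Y}|\boldsymbol{H}}(\boldsymbol{Y})}\right]$. The coefficient $\alpha^{\mathrm{BI}}_\Omega$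 is defined by $\mathsf{I}^{\mathrm{BI}}_\Omega(\mathsf{SNR})=\alpha^{\mathrm{BI}}_\Omega\,\mathsf{SNR}+O(\mathsf{SNR}^2)$ as $\mathsf{SNR}\to 0$.
   Formalization: The formula for the BRGC G_m is proved for m≥2 instead of m≥1: at m=1, G_1=N_1 and the true coefficient is log_2 e (given by the NBC formula), while the G_m formula would give 2 log_2 e. *)

theory Defs
  imports "HOL-Probability.Probability" "HOL-Library.Landau_Symbols"
begin

section \<open>Labelings and the PSK alphabet\<close>

text \<open>A labeling of order \<open>m\<close> is the list of its rows; bit 0 is \<open>False\<close>, bit 1 is \<open>True\<close>.\<close>

definition reflect_labeling :: "bool list list \<Rightarrow> bool list list" where
  "reflect_labeling L = map ((#) False) L @ map ((#) True) (rev L)"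

definition BRGC :: "nat \<Rightarrow> bool list list" where
  "BRGC m = (reflect_labeling ^^ (m - 1)) [[False], [True]]"

definition NBC :: "nat \<Rightarrow> bool list list" where
  "NBC m = map (\<lambda>i::nat. map (\<lambda>k. bit i (m - 1 - k)) [0..<m]) [0..<2 ^ m]"

text \<open>On \<open>bool\<close>, modulo-2 addition is \<open>\<noteq>\<close>.\<close>

definition BSGC :: "nat \<Rightarrow> bool list list" where
  "BSGC m = map (\<lambda>c. (hd c \<noteq> last c) # tl c) (BRGC m)"

definition FBC :: "nat \<Rightarrow> bool list list" where
  "FBC m = reflect_labeling (NBC (m - 1))"

definition psk :: "nat \<Rightarrow> nat \<Rightarrow> real ^ 2" where
  "psk M i = vector [cos ((2 * real i + 1) * pi / real M), sin ((2 * real i + 1) * pi / real M)]"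


section \<open>Constellation and channel\<close>

text \<open>The alphabet is given by its rows \<open>x 0, \<dots>, x (2 ^ m - 1)\<close>.\<close>

definition bits :: "nat \<Rightarrow> bool list pmf" where
  "bits m = replicate_pmf m (bernoulli_pmf (1/2))"

definition symbol :: "(nat \<Rightarrow> real ^ 'n) \<Rightarrow> bool list list \<Rightarrow> bool list \<Rightarrow> real ^ 'n" where
  "symbol x L c = x (THE i. i < length L \<and> L ! i = c)"

definition symbol_energy :: "nat \<Rightarrow> (nat \<Rightarrow> real ^ 'n) \<Rightarrow> bool list list \<Rightarrow> real" where
  "symbol_energy m x L = measure_pmf.expectation (bits m) (\<lambda>c. (norm (symbol x L c))\<^sup>2)"

text \<open>\<open>PH\<close> is the law of the fading vector, \<open>PH1\<close> the common law of its components.\<close>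

definition fading_law :: "(real ^ 'n) measure \<Rightarrow> real measure \<Rightarrow> bool" where
  "fading_law PH PH1 \<longleftrightarrow>
     prob_space PH \<and> sets PH = sets borel \<and>
     (\<forall>j. distr PH borel (\<lambda>h. h $ j) = PH1) \<and>
     integrable PH1 (\<lambda>t. t\<^sup>2) \<and> 0 < (\<integral>t. t\<^sup>2 \<partial>PH1) \<and>
     (\<exists>\<omega>>0. \<forall>\<^sub>F \<Delta> in at_top. measure PH {h. (norm h)\<^sup>2 > \<Delta>} \<le> exp (- (\<Delta> powr \<omega>)))"

definition noise_pdf :: "real \<Rightarrow> real ^ 'n \<Rightarrow> real" where
  "noise_pdf N0 z = (\<Prod>j\<in>UNIV. normal_density 0 (sqrt (N0 / 2)) (z $ j))"

definition noise :: "real \<Rightarrow> (real ^ 'n) measure" where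
  "noise N0 = density lborel (\<lambda>z. ennreal (noise_pdf N0 z))"

text \<open>The joint law of bits, fading and noise.\<close>

definition channel_space ::
    "nat \<Rightarrow> (real ^ 'n) measure \<Rightarrow> real \<Rightarrow> (bool list \<times> (real ^ 'n) \<times> (real ^ 'n)) measure" where
  "channel_space m PH N0 = measure_pmf (bits m) \<Otimes>\<^sub>M (PH \<Otimes>\<^sub>M noise N0)"

text \<open>Multiplication on \<open>real ^ 'n\<close> is the element-wise product.\<close>

definition channel_output ::
    "(nat \<Rightarrow> real ^ 'n) \<Rightarrow> bool list list \<Rightarrow> bool list \<Rightarrow> real ^ 'n \<Rightarrow> real ^ 'n \<Rightarrow> real ^ 'n" where
  "channel_output x L c h z = h * symbol x L c + z"


section \<open>BICM capacity\<close>

text \<open>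
  Conditional density of the output at \<open>y\<close>, given fading \<open>h\<close>, when the bits have law \<open>B\<close>.  Taking
  \<open>B = bits m\<close> gives \<open>p\<close> of Y given H; conditioning \<open>B\<close> on the value of bit \<open>k\<close> gives \<open>p\<close> of Y
  given \<open>C\<^sub>k\<close> and H.  The lemma \<open>output_pdf_correct\<close> shows that these are conditional densities.
\<close>

definition output_pdf ::
    "bool list pmf \<Rightarrow> (nat \<Rightarrow> real ^ 'n) \<Rightarrow> bool list list \<Rightarrow> real \<Rightarrow> real ^ 'n \<Rightarrow> real ^ 'n \<Rightarrow> real" where
  "output_pdf B x L N0 h y =
     measure_pmf.expectation B (\<lambda>c. noise_pdf N0 (y - h * symbol x L c))"

definition bit_law :: "nat \<Rightarrow> nat \<Rightarrow> bool \<Rightarrow> bool list pmf" where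
  "bit_law m k b = cond_pmf (bits m) {c. c ! k = b}"

definition information_density ::
    "nat \<Rightarrow> (nat \<Rightarrow> real ^ 'n) \<Rightarrow> bool list list \<Rightarrow> real \<Rightarrow> nat \<Rightarrow> bool \<Rightarrow> real ^ 'n \<Rightarrow> real ^ 'n \<Rightarrow> real" where
  "information_density m x L N0 k b h y =
     log 2 (output_pdf (bit_law m k b) x L N0 h y / output_pdf (bits m) x L N0 h y)"

definition bicm_capacity ::
    "nat \<Rightarrow> (nat \<Rightarrow> real ^ 'n) \<Rightarrow> bool list list \<Rightarrow> (real ^ 'n) measure \<Rightarrow> real \<Rightarrow> real" where
  "bicm_capacity m x L PH N0 =
     (\<Sum>k<m. \<integral>(c, h, z). information_density m x L N0 k (c ! k) h (channel_output x L c h z)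
              \<partial>channel_space m PH N0)"

definition SNR ::
    "nat \<Rightarrow> (nat \<Rightarrow> real ^ 'n) \<Rightarrow> bool list list \<Rightarrow> real measure \<Rightarrow> real \<Rightarrow> real" where
  "SNR m x L PH1 N0 = (\<integral>t. t\<^sup>2 \<partial>PH1) * symbol_energy m x L / N0"

text \<open>
  \<open>\<alpha>\<close> is the first-order coefficient of the BICM capacity.  \<open>SNR \<rightarrow> 0\<close> is expressed by
  \<open>N0 \<rightarrow> \<infinity>\<close>; uniqueness of \<open>\<alpha>\<close> is \<open>has_bicm_coefficient_unique\<close>.
\<close>

definition has_bicm_coefficient ::
    "nat \<Rightarrow> (nat \<Rightarrow> real ^ 'n) \<Rightarrow> bool list list \<Rightarrow> (real ^ 'n) measure \<Rightarrow> real measure \<Rightarrow> real \<Rightarrow> bool" where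
  "has_bicm_coefficient m x L PH PH1 \<alpha> \<longleftrightarrow>
     (\<lambda>N0. bicm_capacity m x L PH N0 - \<alpha> * SNR m x L PH1 N0) \<in> O[at_top](\<lambda>N0. (SNR m x L PH1 N0)\<^sup>2)"


section \<open>Basic facts about the definitions\<close>

text \<open>At order 1 the two codes coincide, so their coefficients on the same alphabet do too.\<close>

lemma BRGC_1_eq_NBC_1: "BRGC 1 = NBC 1"
  by (simp add: BRGC_def NBC_def bit_0 upt_rec)

lemma set_pmf_bits: "set_pmf (bits m) = {c. length c = m}"
  by (auto simp: bits_def set_replicate_pmf lists_eq_set)

lemma finite_set_pmf_bits: "finite (set_pmf (bits m))"
  using finite_lists_length_eq[of "UNIV :: bool set" m] by (simp add: set_pmf_bits)

lemma SNR_pos: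
  assumes "fading_law PH PH1" "symbol_energy m x L > 0" "N0 > 0"
  shows "SNR m x L PH1 N0 > 0"
  using assms by (simp add: SNR_def fading_law_def)

lemma has_bicm_coefficient_unique:
  assumes fading: "fading_law PH PH1" and energy: "symbol_energy m x L > 0"
    and a: "has_bicm_coefficient m x L PH PH1 a" and b: "has_bicm_coefficient m x L PH PH1 b"
  shows "a = b"
proof (rule ccontr)
  assume "a \<noteq> b"
  let ?K = "(\<integral>t. t\<^sup>2 \<partial>PH1) * symbol_energy m x L"
  have K: "?K > 0"
    using fading energy by (simp add: fading_law_def)
  have "(\<lambda>N0. (b - a) * SNR m x L PH1 N0) \<in> O[at_top](\<lambda>N0. (SNR m x L PH1 N0)\<^sup>2)"
    using sum_in_bigo(2)[OF a[unfolded has_bicm_coefficient_def] b[unfolded has_bicm_coefficient_def]]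
    by (simp add: algebra_simps)
  then have "(\<lambda>N0. SNR m x L PH1 N0) \<in> O[at_top](\<lambda>N0. (SNR m x L PH1 N0)\<^sup>2)"
    using \<open>a \<noteq> b\<close> by simp
  then obtain c where "c > 0"
    and ev: "\<forall>\<^sub>F N0 in at_top. norm (SNR m x L PH1 N0) \<le> c * norm ((SNR m x L PH1 N0)\<^sup>2)"
    by (auto elim: landau_o.bigE)
  have "\<forall>\<^sub>F N0 in at_top. N0 > max 0 (c * ?K)"
    by (rule eventually_gt_at_top)
  with ev have "\<forall>\<^sub>F N0 :: real in at_top. False"
  proof eventually_elim
    case (elim N0)
    then have N0: "N0 > 0" "N0 > c * ?K" by auto
    have "?K / N0 \<le> c * (?K / N0)\<^sup>2"
      using elim(1) SNR_pos[OF fading energy N0(1)] unfolding SNR_def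
      by (metis abs_of_pos real_norm_def zero_less_power)
    then have "?K * N0 \<le> ?K * (c * ?K)"
      using N0 by (simp add: power_divide power2_eq_square field_simps)
    then have "N0 \<le> c * ?K"
      using K by (metis mult_le_cancel_left_pos)
    with N0 show False by simp
  qed
  then show False by simp
qed

lemma norm_psk: "norm (psk M i) = 1"
  by (simp add: psk_def norm_vec_def L2_set_def UNIV_2)

lemma symbol_energy_psk: "symbol_energy m (psk M) L = 1"
  by (simp add: symbol_energy_def symbol_def norm_psk)

lemma noise_pdf_nonneg [simp]: "noise_pdf N0 z \<ge> 0"
  by (simp add: noise_pdf_def prod_nonneg)

lemma noise_pdf_pos: "N0 > 0 \<Longrightarrow> noise_pdf N0 z > 0"
  by (simp add: noise_pdf_def prod_pos normal_density_pos)

lemma noise_pdf_measurable [measurable]: "noise_pdf N0 \<in> borel_measurable borel"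
  unfolding noise_pdf_def by measurable

lemma times_vec_measurable [measurable]: "(\<lambda>h :: real ^ 'n. h * v) \<in> borel_measurable borel"
proof -
  have "(\<lambda>h :: real ^ 'n. h * v) = (\<lambda>h. \<chi> j. h $ j * v $ j)"
    by (simp add: times_vec_def)
  then show ?thesis
    by (auto intro!: borel_measurable_continuous_onI continuous_intros)
qed

lemma nn_integral_noise_pdf:
  assumes "N0 > 0"
  shows "(\<integral>\<^sup>+z. ennreal (noise_pdf N0 z) \<partial>(lborel :: (real ^ 'n) measure)) = 1"
proof -
  let ?f = "\<lambda>t. ennreal (normal_density 0 (sqrt (N0 / 2)) t)"
  have eq: "ennreal (noise_pdf N0 z) = (\<Prod>b\<in>Basis. ?f (z \<bullet> b))" for z :: "real ^ 'n"
  proof -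
    have inj: "inj (\<lambda>j :: 'n. axis j (1 :: real))"
      by (rule injI) (simp add: axis_eq_axis)
    have basis: "(Basis :: (real ^ 'n) set) = range (\<lambda>j. axis j 1)"
      by (auto simp: Basis_vec_def)
    have "(\<Prod>b\<in>Basis. ?f (z \<bullet> b)) = (\<Prod>j\<in>UNIV. ?f (z $ j))"
      unfolding basis by (subst prod.reindex[OF inj]) (simp add: inner_axis)
    also have "\<dots> = ennreal (noise_pdf N0 z)"
      by (simp add: noise_pdf_def prod_ennreal)
    finally show ?thesis by simp
  qed
  have one: "(\<integral>\<^sup>+t. ?f t \<partial>lborel) = 1"
    using assms by (subst nn_integral_eq_integral) (auto simp: integral_normal_density)
  show ?thesis
    unfolding eq by (subst nn_integral_lborel_prod) (auto simp: one)
qed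

lemma prob_space_noise: "N0 > 0 \<Longrightarrow> prob_space (noise N0)"
  by (rule prob_spaceI) (simp add: noise_def emeasure_density nn_integral_noise_pdf)

lemma nn_integral_lborel_translate:
  assumes [measurable]: "g \<in> borel_measurable borel"
  shows "(\<integral>\<^sup>+z. g (a + z) \<partial>lborel) = (\<integral>\<^sup>+y. g y \<partial>(lborel :: (real ^ 'n) measure))"
proof -
  have "(\<integral>\<^sup>+y. g y \<partial>lborel) = (\<integral>\<^sup>+y. g y \<partial>distr lborel borel ((+) a))"
    by (simp add: lborel_distr_plus)
  then show ?thesis by (simp add: nn_integral_distr)
qed

lemma channel_output_measurable:
  "(\<lambda>(h, z). (h, channel_output x L c h z)) \<in> borel \<Otimes>\<^sub>M borel \<rightarrow>\<^sub>M borel \<Otimes>\<^sub>M borel"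
  unfolding channel_output_def case_prod_beta by measurable

lemma sets_bits_pair: "sets (measure_pmf p \<Otimes>\<^sub>M N) = sets (count_space UNIV \<Otimes>\<^sub>M N)"
  by (rule sets_pair_measure_cong) simp_all

lemma nn_integral_channel_space:
  assumes PH: "prob_space PH" "sets PH = sets borel" and N0: "N0 > 0"
    and F: "\<And>c. (\<lambda>(h, y). F c h y) \<in> borel_measurable (borel \<Otimes>\<^sub>M borel)"
  shows "(\<integral>\<^sup>+(c, h, z). F c h (channel_output x L c h z) \<partial>channel_space m PH N0) =
         (\<integral>\<^sup>+c. (\<integral>\<^sup>+h. (\<integral>\<^sup>+y. F c h y * noise_pdf N0 (y - h * symbol x L c) \<partial>lborel) \<partial>PH)
            \<partial>measure_pmf (bits m))"
proof -
  interpret PH: prob_space PH by fact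
  interpret noise: prob_space "noise N0 :: (real ^ 'a) measure" using N0 by (rule prob_space_noise)
  interpret HZ: pair_sigma_finite PH "noise N0 :: (real ^ 'a) measure" ..
  note [measurable_cong] = PH(2)
  have sets_noise [measurable_cong]: "sets (noise N0 :: (real ^ 'a) measure) = sets borel"
    by (simp add: noise_def)
  have Fm [measurable]: "(\<lambda>(h, z). F c h (channel_output x L c h z)) \<in> borel_measurable (borel \<Otimes>\<^sub>M borel)" for c
    using measurable_compose[OF channel_output_measurable F] by (simp add: case_prod_beta)
  have inner: "(\<integral>\<^sup>+(h, z). F c h (channel_output x L c h z) \<partial>(PH \<Otimes>\<^sub>M noise N0)) =
      (\<integral>\<^sup>+h. (\<integral>\<^sup>+y. F c h y * noise_pdf N0 (y - h * symbol x L c) \<partial>lborel) \<partial>PH)" for c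
  proof -
    have "(\<integral>\<^sup>+(h, z). F c h (channel_output x L c h z) \<partial>(PH \<Otimes>\<^sub>M noise N0)) =
      (\<integral>\<^sup>+h. (\<integral>\<^sup>+z. F c h (channel_output x L c h z) \<partial>noise N0) \<partial>PH)"
      by (subst noise.nn_integral_fst[symmetric]) (auto simp: case_prod_beta)
    also have "\<dots> = (\<integral>\<^sup>+h. (\<integral>\<^sup>+y. F c h y * noise_pdf N0 (y - h * symbol x L c) \<partial>lborel) \<partial>PH)"
    proof (intro nn_integral_cong)
      fix h :: "real ^ 'a"
      have [measurable]: "F c h \<in> borel_measurable borel"
        using measurable_Pair2[OF F[of c], of h] by simp
      have "(\<integral>\<^sup>+z. F c h (channel_output x L c h z) \<partial>noise N0) =
          (\<integral>\<^sup>+z. ennreal (noise_pdf N0 z) * F c h (h * symbol x L c + z) \<partial>lborel)"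
        unfolding noise_def channel_output_def by (subst nn_integral_density) auto
      also have "\<dots> = (\<integral>\<^sup>+z. (\<lambda>y. F c h y * noise_pdf N0 (y - h * symbol x L c))
          (h * symbol x L c + z) \<partial>lborel)"
        by (simp add: mult.commute)
      also have "\<dots> = (\<integral>\<^sup>+y. F c h y * noise_pdf N0 (y - h * symbol x L c) \<partial>lborel)"
        by (rule nn_integral_lborel_translate) measurable
      finally show "(\<integral>\<^sup>+z. F c h (channel_output x L c h z) \<partial>noise N0) =
          (\<integral>\<^sup>+y. F c h y * noise_pdf N0 (y - h * symbol x L c) \<partial>lborel)" .
    qed
    finally show ?thesis .
  qed
  have meas: "(\<lambda>(c, h, z). F c h (channel_output x L c h z))
      \<in> borel_measurable (measure_pmf (bits m) \<Otimes>\<^sub>M (PH \<Otimes>\<^sub>M noise N0))"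
  proof -
    have "(\<lambda>(c, h, z). F c h (channel_output x L c h z))
        \<in> borel_measurable (count_space UNIV \<Otimes>\<^sub>M (PH \<Otimes>\<^sub>M noise N0))"
      by (rule measurable_pair_measure_countable1) auto
    then show ?thesis
      by (simp add: measurable_cong_sets[OF sets_bits_pair refl])
  qed
  have sf: "sigma_finite_measure (PH \<Otimes>\<^sub>M (noise N0 :: (real ^ 'a) measure))"
    by unfold_locales
  show ?thesis
    unfolding channel_space_def
    by (subst sigma_finite_measure.nn_integral_fst[OF sf meas, symmetric]) (simp add: inner)
qed

lemma output_pdf_nonneg: "output_pdf B x L N0 h y \<ge> 0"
  by (simp add: output_pdf_def)

text \<open>
  For an event \<open>A\<close> on the bits, \<open>output_pdf (cond_pmf (bits m) A)\<close> is the conditional density of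
  the output given \<open>A\<close> and the fading.
\<close>

lemma output_pdf_correct:
  fixes PH :: "(real ^ 'n) measure" and G :: "real ^ 'n \<Rightarrow> real ^ 'n \<Rightarrow> ennreal"
  assumes PH: "prob_space PH" "sets PH = sets borel" and N0: "N0 > 0"
    and A: "set_pmf (bits m) \<inter> A \<noteq> {}"
    and G: "(\<lambda>(h, y). G h y) \<in> borel_measurable (borel \<Otimes>\<^sub>M borel)"
  shows "(\<integral>\<^sup>+(c, h, z). indicator A c * G h (channel_output x L c h z) \<partial>channel_space m PH N0) =
         measure_pmf.prob (bits m) A *
           (\<integral>\<^sup>+h. (\<integral>\<^sup>+y. G h y * output_pdf (cond_pmf (bits m) A) x L N0 h y \<partial>lborel) \<partial>PH)"
proof -
  let ?B = "cond_pmf (bits m) A"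
  let ?n = "\<lambda>c h y. ennreal (noise_pdf N0 (y - h * symbol x L c))"
  note [measurable_cong] = PH(2)
  have [measurable]: "(\<lambda>(h, y). indicator A c * G h y) \<in> borel_measurable (borel \<Otimes>\<^sub>M borel)" for c
    using G by (auto simp: case_prod_beta)
  note G [measurable]
  have fin: "finite (set_pmf ?B)"
    using A finite_set_pmf_bits[of m] by simp
  have [measurable]: "(\<lambda>(h, y). G h y * ?n c h y) \<in> borel_measurable (borel \<Otimes>\<^sub>M borel)" for c
    unfolding case_prod_beta by measurable
  have [measurable]: "(\<lambda>y. G h y * ?n c h y) \<in> borel_measurable borel" for c h
    using measurable_Pair2[of "\<lambda>(h, y). G h y * ?n c h y" borel borel borel h] by simp
  have [measurable]: "(\<lambda>h. \<integral>\<^sup>+y. G h y * ?n c h y \<partial>lborel) \<in> borel_measurable PH" for c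
    by (rule sigma_finite_measure.borel_measurable_nn_integral[OF sigma_finite_lborel]) measurable
  have pdf: "ennreal (output_pdf ?B x L N0 h y) = (\<Sum>c\<in>set_pmf ?B. ennreal (pmf ?B c) * ?n c h y)" for h y
    unfolding output_pdf_def
    by (subst integral_measure_pmf_real[OF fin])
      (auto simp: mult.commute set_pmf_iff sum_ennreal simp flip: ennreal_mult)
  have "(\<integral>\<^sup>+(c, h, z). indicator A c * G h (channel_output x L c h z) \<partial>channel_space m PH N0) =
      (\<integral>\<^sup>+c. (\<integral>\<^sup>+h. (\<integral>\<^sup>+y. indicator A c * G h y * ?n c h y \<partial>lborel) \<partial>PH) \<partial>measure_pmf (bits m))"
    by (rule nn_integral_channel_space[OF PH N0]) measurable
  also have "\<dots> = (\<integral>\<^sup>+c. (\<integral>\<^sup>+h. (\<integral>\<^sup>+y. G h y * ?n c h y \<partial>lborel) \<partial>PH) * indicator A c \<partial>measure_pmf (bits m))"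
    by (intro nn_integral_cong) (auto simp: indicator_def)
  also have "\<dots> = measure_pmf.prob (bits m) A *
      (\<integral>\<^sup>+c. (\<integral>\<^sup>+h. (\<integral>\<^sup>+y. G h y * ?n c h y \<partial>lborel) \<partial>PH) \<partial>measure_pmf ?B)"
  proof -
    have pos: "measure_pmf.prob (bits m) A > 0"
      using measure_measure_pmf_not_zero[of "bits m" A] A by (simp add: zero_less_measure_iff)
    have cancel: "a = ennreal (measure_pmf.prob (bits m) A) *
        (a / ennreal (measure_pmf.prob (bits m) A))" for a
      using mult_divide_eq_ennreal[of "ennreal (measure_pmf.prob (bits m) A)" a] pos
      by (simp add: ennreal_times_divide mult.commute)
    show ?thesis
      unfolding cond_pmf.rep_eq[OF A]
      by (subst nn_integral_uniform_measure)
        (auto simp: measure_pmf.emeasure_eq_measure intro: cancel)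
  qed
  also have "(\<integral>\<^sup>+c. (\<integral>\<^sup>+h. (\<integral>\<^sup>+y. G h y * ?n c h y \<partial>lborel) \<partial>PH) \<partial>measure_pmf ?B) =
      (\<Sum>c\<in>set_pmf ?B. (\<integral>\<^sup>+h. (\<integral>\<^sup>+y. G h y * ?n c h y \<partial>lborel) \<partial>PH) * pmf ?B c)"
    using fin by (rule nn_integral_measure_pmf_finite) simp
  also have "\<dots> = (\<integral>\<^sup>+h. (\<integral>\<^sup>+y. G h y * output_pdf ?B x L N0 h y \<partial>lborel) \<partial>PH)"
  proof -
    have "(\<integral>\<^sup>+y. G h y * output_pdf ?B x L N0 h y \<partial>lborel) =
        (\<Sum>c\<in>set_pmf ?B. (\<integral>\<^sup>+y. G h y * ?n c h y \<partial>lborel) * pmf ?B c)" for h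
    proof -
      have "(\<integral>\<^sup>+y. G h y * output_pdf ?B x L N0 h y \<partial>lborel) =
          (\<integral>\<^sup>+y. (\<Sum>c\<in>set_pmf ?B. G h y * ?n c h y * pmf ?B c) \<partial>lborel)"
        unfolding pdf sum_distrib_left by (intro nn_integral_cong sum.cong refl) (simp only: ac_simps)
      also have "\<dots> = (\<Sum>c\<in>set_pmf ?B. (\<integral>\<^sup>+y. G h y * ?n c h y * pmf ?B c \<partial>lborel))"
        by (rule nn_integral_sum) measurable
      also have "\<dots> = (\<Sum>c\<in>set_pmf ?B. (\<integral>\<^sup>+y. G h y * ?n c h y \<partial>lborel) * pmf ?B c)"
        by (intro sum.cong refl nn_integral_multc) measurable
      finally show ?thesis .
    qed
    then have "(\<integral>\<^sup>+h. (\<integral>\<^sup>+y. G h y * output_pdf ?B x L N0 h y \<partial>lborel) \<partial>PH) =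
        (\<Sum>c\<in>set_pmf ?B. (\<integral>\<^sup>+h. (\<integral>\<^sup>+y. G h y * ?n c h y \<partial>lborel) * pmf ?B c \<partial>PH))"
      by (simp add: nn_integral_sum)
    also have "\<dots> = (\<Sum>c\<in>set_pmf ?B. (\<integral>\<^sup>+h. (\<integral>\<^sup>+y. G h y * ?n c h y \<partial>lborel) \<partial>PH) * pmf ?B c)"
      by (intro sum.cong refl nn_integral_multc) measurable
    finally show ?thesis by simp
  qed
  finally show ?thesis .
qed

lemma output_pdf_measurable:
  assumes fin: "finite (set_pmf B)"
  shows "(\<lambda>(h, y). output_pdf B x L N0 h y) \<in> borel_measurable (borel \<Otimes>\<^sub>M borel)"
proof -
  have "(\<lambda>(h, y). output_pdf B x L N0 h y) =
      (\<lambda>(h, y). \<Sum>c\<in>set_pmf B. noise_pdf N0 (y - h * symbol x L c) * pmf B c)"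
    unfolding output_pdf_def by (subst integral_measure_pmf_real[OF fin]) auto
  also have "\<dots> \<in> borel_measurable (borel \<Otimes>\<^sub>M borel)"
    unfolding case_prod_beta by measurable
  finally show ?thesis .
qed

lemma nn_integral_output_pdf:
  fixes h :: "real ^ 'n"
  assumes fin: "finite (set_pmf B)" and N0: "N0 > 0"
  shows "(\<integral>\<^sup>+y. ennreal (output_pdf B x L N0 h y) \<partial>lborel) = 1"
proof -
  have one: "(\<integral>\<^sup>+y. ennreal (noise_pdf N0 (y - h * v)) \<partial>lborel) = 1" for v
    using nn_integral_lborel_translate[of "\<lambda>z. ennreal (noise_pdf N0 z)" "- (h * v)"]
    by (simp add: nn_integral_noise_pdf[OF N0])
  have eq: "ennreal (output_pdf B x L N0 h y) =
      (\<Sum>c\<in>set_pmf B. ennreal (pmf B c) * ennreal (noise_pdf N0 (y - h * symbol x L c)))" for y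
    unfolding output_pdf_def
    by (subst integral_measure_pmf_real[OF fin])
      (auto simp: mult.commute set_pmf_iff sum_ennreal simp flip: ennreal_mult)
  have "(\<integral>\<^sup>+y. ennreal (output_pdf B x L N0 h y) \<partial>lborel) = (\<Sum>c\<in>set_pmf B. ennreal (pmf B c))"
    unfolding eq by (simp add: nn_integral_sum nn_integral_cmult one)
  also have "\<dots> = 1"
    using fin by (simp add: sum_ennreal sum_pmf_eq_1)
  finally show ?thesis .
qed

lemma output_pdf_pos:
  assumes fin: "finite (set_pmf B)" and N0: "N0 > 0"
  shows "output_pdf B x L N0 h y > 0"
  unfolding output_pdf_def
  by (subst integral_measure_pmf_real[OF fin])
    (auto intro!: sum_pos fin simp: set_pmf_not_empty noise_pdf_pos[OF N0] pmf_positive)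

lemma set_pmf_bits_bit: "k < m \<Longrightarrow> set_pmf (bits m) \<inter> {c. c ! k = b} \<noteq> {}"
proof -
  assume "k < m"
  then have "replicate m b \<in> set_pmf (bits m) \<inter> {c. c ! k = b}"
    by (simp add: set_pmf_bits)
  then show ?thesis by blast
qed

lemma output_pdf_bit_law_le:
  assumes k: "k < m"
  shows "output_pdf (bit_law m k b) x L N0 h y
           \<le> output_pdf (bits m) x L N0 h y / measure_pmf.prob (bits m) {c. c ! k = b}"
proof -
  let ?P = "measure_pmf.prob (bits m) {c. c ! k = b}"
  let ?n = "\<lambda>c. noise_pdf N0 (y - h * symbol x L c)"
  note ne = set_pmf_bits_bit[OF k, of b]
  have fin: "finite (set_pmf (bit_law m k b))"
    using finite_set_pmf_bits[of m] by (simp add: bit_law_def ne)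
  have "output_pdf (bit_law m k b) x L N0 h y =
      (\<Sum>c\<in>set_pmf (bit_law m k b). ?n c * pmf (bits m) c / ?P)"
    unfolding output_pdf_def
    by (subst integral_measure_pmf_real[OF fin]) (auto simp: bit_law_def ne pmf_cond intro!: sum.cong)
  also have "\<dots> \<le> (\<Sum>c\<in>set_pmf (bits m). ?n c * pmf (bits m) c / ?P)"
    by (rule sum_mono2[OF finite_set_pmf_bits]) (auto simp: bit_law_def ne)
  also have "\<dots> = output_pdf (bits m) x L N0 h y / ?P"
    unfolding output_pdf_def
    by (subst integral_measure_pmf_real[OF finite_set_pmf_bits]) (auto simp: sum_divide_distrib)
  finally show ?thesis .
qed

text \<open>The expectations in \<open>bicm_capacity\<close> are those of integrable random variables.\<close>

lemma integrable_information_density: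
  fixes PH :: "(real ^ 'n) measure"
  assumes PH: "prob_space PH" "sets PH = sets borel" and N0: "N0 > 0" and k: "k < m"
  shows "integrable (channel_space m PH N0)
    (\<lambda>(c, h, z). information_density m x L N0 k (c ! k) h (channel_output x L c h z))"
proof -
  interpret PH: prob_space PH by fact
  let ?i = "information_density m x L N0 k"
  let ?p1 = "\<lambda>b. output_pdf (bit_law m k b) x L N0"
  let ?p0 = "output_pdf (bits m) x L N0"
  let ?P = "\<lambda>b. measure_pmf.prob (bits m) {c. c ! k = b}"
  note ne = set_pmf_bits_bit[OF k]
  note [measurable_cong] = PH(2)
  have fin1: "finite (set_pmf (bit_law m k b))" for b
    using finite_set_pmf_bits[of m] by (simp add: bit_law_def ne)
  note fin0 = finite_set_pmf_bits[of m]
  note p1m = output_pdf_measurable[OF fin1, where x = x and L = L and ?N0.0 = N0]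
  note p0m = output_pdf_measurable[OF fin0, where x = x and L = L and ?N0.0 = N0]
  have P: "?P b > 0" for b
    using measure_measure_pmf_not_zero[OF ne[of b]] by (simp add: zero_less_measure_iff)
  have im [measurable]: "(\<lambda>(h, y). ?i b h y) \<in> borel_measurable (borel \<Otimes>\<^sub>M borel)" for b
    using p1m[of b] p0m unfolding information_density_def case_prod_beta by measurable
  have meas: "(\<lambda>(c, h, z). ?i (c ! k) h (channel_output x L c h z))
      \<in> borel_measurable (channel_space m PH N0)"
  proof -
    have [measurable]: "(\<lambda>(h, z). ?i b h (channel_output x L c h z)) \<in> borel_measurable (borel \<Otimes>\<^sub>M borel)" for b c
      using measurable_compose[OF channel_output_measurable im] by (simp add: case_prod_beta)
    have [measurable_cong]: "sets (noise N0 :: (real ^ 'n) measure) = sets borel"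
      by (simp add: noise_def)
    have "(\<lambda>(c, h, z). ?i (c ! k) h (channel_output x L c h z))
        \<in> borel_measurable (count_space UNIV \<Otimes>\<^sub>M (PH \<Otimes>\<^sub>M noise N0))"
      by (rule measurable_pair_measure_countable1) auto
    then show ?thesis
      unfolding channel_space_def
      by (simp add: measurable_cong_sets[OF sets_bits_pair refl])
  qed
  have bound: "\<bar>?i b h y\<bar> * ?p1 b h y \<le> (?p1 b h y / ?P b + ?p0 h y) / ln 2" for b h y
  proof -
    define p q where "p = ?p1 b h y" and "q = ?p0 h y"
    have pq: "p > 0" "q > 0" "p \<le> q / ?P b"
      unfolding p_def q_def
      by (auto intro: output_pdf_pos fin1 fin0 N0 output_pdf_bit_law_le k)
    have "\<bar>ln (p / q)\<bar> \<le> p / q + q / p"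
    proof -
      have "ln (p / q) \<le> p / q" "ln (q / p) \<le> q / p"
        using pq ln_le_minus_one[of "p / q"] ln_le_minus_one[of "q / p"] by auto
      moreover have "ln (q / p) = - ln (p / q)"
        using pq by (simp add: ln_div)
      moreover have "p / q > 0" "q / p > 0"
        using pq by auto
      ultimately show ?thesis by linarith
    qed
    then have "\<bar>ln (p / q)\<bar> * p \<le> (p / q + q / p) * p"
      using pq by (intro mult_right_mono) auto
    also have "\<dots> = p / q * p + q"
      using pq by (simp add: field_simps)
    also have "p / q * p \<le> 1 / ?P b * p"
      using pq P[of b] by (intro mult_right_mono) (auto simp: field_simps)
    finally have "\<bar>ln (p / q)\<bar> * p \<le> p / ?P b + q" by simp
    then show ?thesis
      unfolding information_density_def p_def[symmetric] q_def[symmetric]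
      by (simp add: log_def divide_right_mono)
  qed
  have "(\<integral>\<^sup>+(c, h, z). ennreal \<bar>?i (c ! k) h (channel_output x L c h z)\<bar> \<partial>channel_space m PH N0) =
      (\<integral>\<^sup>+w. (\<Sum>b\<in>UNIV. (case w of (c, h, z) \<Rightarrow>
         indicator {c. c ! k = b} c * ennreal \<bar>?i b h (channel_output x L c h z)\<bar>)) \<partial>channel_space m PH N0)"
    by (intro nn_integral_cong) (auto simp: UNIV_bool indicator_def)
  also have "\<dots> = (\<Sum>b\<in>UNIV. (\<integral>\<^sup>+(c, h, z). indicator {c. c ! k = b} c *
       ennreal \<bar>?i b h (channel_output x L c h z)\<bar> \<partial>channel_space m PH N0))"
  proof (rule nn_integral_sum)
    fix b
    have [measurable]: "(\<lambda>(h, z). ?i b h (channel_output x L c h z)) \<in> borel_measurable (borel \<Otimes>\<^sub>M borel)" for c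
      using measurable_compose[OF channel_output_measurable im] by (simp add: case_prod_beta)
    have [measurable_cong]: "sets (noise N0 :: (real ^ 'n) measure) = sets borel"
      by (simp add: noise_def)
    have "(\<lambda>(c, h, z). indicator {c. c ! k = b} c * ennreal \<bar>?i b h (channel_output x L c h z)\<bar>)
        \<in> borel_measurable (count_space UNIV \<Otimes>\<^sub>M (PH \<Otimes>\<^sub>M noise N0))"
    proof (rule measurable_pair_measure_countable1)
      fix c :: "bool list"
      have "(\<lambda>(h, z). indicator {c. c ! k = b} c * ennreal \<bar>?i b h (channel_output x L c h z)\<bar>)
          \<in> borel_measurable (borel \<Otimes>\<^sub>M borel)"
        unfolding case_prod_beta by measurable
      then show "(\<lambda>y. case (c, y) of (c, h, z) \<Rightarrow> indicator {c. c ! k = b} c *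
          ennreal \<bar>?i b h (channel_output x L c h z)\<bar>) \<in> borel_measurable (PH \<Otimes>\<^sub>M noise N0)"
        by (simp cong: measurable_cong_sets)
    qed auto
    then show "(\<lambda>(c, h, z). indicator {c. c ! k = b} c * ennreal \<bar>?i b h (channel_output x L c h z)\<bar>)
        \<in> borel_measurable (channel_space m PH N0)"
      unfolding channel_space_def
      by (simp add: measurable_cong_sets[OF sets_bits_pair refl])
  qed
  also have "\<dots> < \<infinity>"
  proof -
    have "(\<integral>\<^sup>+(c, h, z). indicator {c. c ! k = b} c *
        ennreal \<bar>?i b h (channel_output x L c h z)\<bar> \<partial>channel_space m PH N0) < \<infinity>" (is "?J < _") for b
    proof -
      have "?J = ?P b * (\<integral>\<^sup>+h. (\<integral>\<^sup>+y. ennreal \<bar>?i b h y\<bar> * ?p1 b h y \<partial>lborel) \<partial>PH)"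
        unfolding bit_law_def
        by (rule output_pdf_correct[OF PH N0 ne]) measurable
      also have "(\<integral>\<^sup>+h. (\<integral>\<^sup>+y. ennreal \<bar>?i b h y\<bar> * ?p1 b h y \<partial>lborel) \<partial>PH) \<le>
          (\<integral>\<^sup>+h. ennreal ((1 / ?P b + 1) / ln 2) \<partial>PH)"
      proof (rule nn_integral_mono)
        fix h
        have [measurable]: "?p1 b h \<in> borel_measurable borel" "?p0 h \<in> borel_measurable borel"
          using measurable_Pair2[OF p1m[of b], of h] measurable_Pair2[OF p0m, of h] by simp_all
        have "(\<integral>\<^sup>+y. ennreal \<bar>?i b h y\<bar> * ?p1 b h y \<partial>lborel) \<le>
            (\<integral>\<^sup>+y. ennreal (1 / (?P b * ln 2)) * ?p1 b h y + ennreal (1 / ln 2) * ?p0 h y \<partial>lborel)"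
        proof (rule nn_integral_mono)
          fix y
          have "ennreal \<bar>?i b h y\<bar> * ?p1 b h y = ennreal (\<bar>?i b h y\<bar> * ?p1 b h y)"
            by (simp add: ennreal_mult output_pdf_nonneg)
          also have "\<dots> \<le> ennreal ((?p1 b h y / ?P b + ?p0 h y) / ln 2)"
            by (rule ennreal_leI[OF bound])
          also have "\<dots> = ennreal (1 / (?P b * ln 2) * ?p1 b h y + 1 / ln 2 * ?p0 h y)"
            by (simp add: add_divide_distrib)
          also have "\<dots> = ennreal (1 / (?P b * ln 2)) * ?p1 b h y + ennreal (1 / ln 2) * ?p0 h y"
            using P[of b] by (simp add: ennreal_plus ennreal_mult[symmetric] output_pdf_nonneg)
          finally show "ennreal \<bar>?i b h y\<bar> * ?p1 b h y \<le>
            ennreal (1 / (?P b * ln 2)) * ?p1 b h y + ennreal (1 / ln 2) * ?p0 h y" .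
        qed
        also have "\<dots> = ennreal (1 / (?P b * ln 2)) + ennreal (1 / ln 2)"
          by (simp add: nn_integral_add nn_integral_cmult nn_integral_output_pdf[OF fin1 N0]
              nn_integral_output_pdf[OF fin0 N0])
        also have "\<dots> = ennreal ((1 / ?P b + 1) / ln 2)"
          using P[of b] by (simp add: add_divide_distrib flip: ennreal_plus)
        finally show "(\<integral>\<^sup>+y. ennreal \<bar>?i b h y\<bar> * ?p1 b h y \<partial>lborel) \<le> ennreal ((1 / ?P b + 1) / ln 2)" .
      qed
      finally have "?J \<le> ?P b * ennreal ((1 / ?P b + 1) / ln 2)"
        by (simp add: mult_left_mono PH.emeasure_space_1)
      also have "\<dots> < \<infinity>"
        by (simp add: ennreal_mult_less_top)
      finally show ?thesis .
    qed
    from this[of True] this[of False] show ?thesis by (simp add: UNIV_bool)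
  qed
  finally show ?thesis
    by (intro integrableI_bounded meas) (simp add: case_prod_unfold)
qed

end

theory Submission
  imports Defs "HOL-Real_Asymp.Real_Asymp"
begin

text \<open>
  Divide all densities by the noise density.  Each conditional output density becomes a finite
  mixture \<open>l\<close> of likelihood ratios of shifted Gaussians, and the information conveyed by one bit
  is a difference of integrals of \<open>l ln l\<close> under the noise law.  Expanding \<open>l ln l\<close> around
  \<open>l = 1\<close> and evaluating the central moments exactly by the Gaussian moment generating function gives
  the squared norm of the mean codeword divided by \<open>N0\<close>, with an error of order
  \<open>norm h ^ 4 / N0 ^ 2\<close>; the tail condition makes \<open>norm h ^ 4\<close> integrable.  For any labeling
  the coefficient is therefore \<open>log 2 e / M ^ 2\<close> times the sum over the bit positions \<open>k\<close> of
  the squared norm of the signed sum of the \<open>x i\<close>, with signs given by column \<open>k\<close>, divided by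
  the symbol energy.

  In all four codes the bits of row \<open>i\<close> are modulo-2 sums of binary digits of \<open>i\<close>, so the signs
  are Walsh functions.  For PSK the signed sum then factors into a product of terms
  \<open>1 + w ^ 2 ^ j\<close> and \<open>1 - w ^ 2 ^ j\<close> with \<open>w = cis (2 * pi / M)\<close>.  The factor for the top
  digit is \<open>0\<close> unless that digit occurs in the sum, and the remaining product telescopes by
  \<open>sin (2 * t) = 2 * sin t * cos t\<close>.
\<close>

section \<open>Labelings\<close>

text \<open>This is what makes the \<open>THE\<close> in \<open>symbol\<close> pick a unique row for
  each bit vector of length \<open>m\<close>, and sums over bit vectors sums over row
  indices.\<close>

definition labeling :: "nat \<Rightarrow> bool list list \<Rightarrow> bool" where
  "labeling m L \<longleftrightarrow> distinct L \<and> set L = {c. length c = m}"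

lemma labeling_length:
  assumes "labeling m L"
  shows "length L = 2 ^ m"
proof -
  have "length L = card (set L)"
    using assms distinct_card[of L] by (simp add: labeling_def)
  also have "\<dots> = 2 ^ m"
    using assms card_lists_length_eq[of "UNIV :: bool set" m] by (simp add: labeling_def)
  finally show ?thesis .
qed

lemma labeling_reflect:
  assumes "labeling m L"
  shows "labeling (Suc m) (reflect_labeling L)"
proof -
  have "set (reflect_labeling L) = {c. length c = Suc m}"
  proof (intro set_eqI iffI)
    fix c :: "bool list"
    assume "c \<in> {c. length c = Suc m}"
    then obtain b d where "c = b # d" "length d = m"
      by (auto simp: length_Suc_conv)
    then show "c \<in> set (reflect_labeling L)"
      using assms by (cases b) (auto simp: reflect_labeling_def labeling_def)
  qed (use assms in \<open>auto simp: reflect_labeling_def labeling_def\<close>)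
  moreover have "distinct (reflect_labeling L)"
    using assms by (auto simp: reflect_labeling_def labeling_def distinct_map)
  ultimately show ?thesis
    by (simp add: labeling_def)
qed

lemma nth_reflect_labeling:
  assumes "i < 2 * length L"
  shows "reflect_labeling L ! i =
    (if i < length L then False # L ! i else True # L ! (2 * length L - 1 - i))"
  using assms by (auto simp: reflect_labeling_def nth_append rev_nth intro!: arg_cong[of _ _ "(!) L"])

lemma nth_NBC: "i < 2 ^ m \<Longrightarrow> NBC m ! i = map (\<lambda>k. bit i (m - 1 - k)) [0..<m]"
  by (simp add: NBC_def)

text \<open>An index below \<open>2 ^ m\<close> is determined by its lowest \<open>m\<close> digits,
  so the rows are distinct; counting then shows that they exhaust all words.\<close>

lemma labeling_NBC: "labeling m (NBC m)"
proof -
  have inj: "inj_on (\<lambda>i::nat. map (\<lambda>k. bit i (m - 1 - k)) [0..<m]) {0..<2 ^ m}"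
  proof (rule inj_onI)
    fix i j :: nat
    assume ij: "i \<in> {0..<2 ^ m}" "j \<in> {0..<2 ^ m}"
      and eq: "map (\<lambda>k. bit i (m - 1 - k)) [0..<m] = map (\<lambda>k. bit j (m - 1 - k)) [0..<m]"
    have "bit i n = bit j n" if "n < m" for n
      using arg_cong[OF eq, of "\<lambda>c. c ! (m - 1 - n)"] that by simp
    then have "take_bit m i = take_bit m j"
      by (intro bit_eqI) (auto simp: bit_take_bit_iff)
    with ij show "i = j"
      by (simp add: take_bit_nat_eq_self)
  qed
  then have "distinct (NBC m)"
    by (simp add: NBC_def distinct_map)
  moreover have "set (NBC m) = {c. length c = m}"
  proof (rule card_subset_eq)
    show "finite {c :: bool list. length c = m}"
      using finite_lists_length_eq[of "UNIV :: bool set" m] by simp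
    show "card (set (NBC m)) = card {c :: bool list. length c = m}"
      using distinct_card[OF \<open>distinct (NBC m)\<close>] card_lists_length_eq[of "UNIV :: bool set" m]
      by (simp add: NBC_def)
  qed (auto simp: NBC_def)
  ultimately show ?thesis
    by (simp add: labeling_def)
qed

lemma BRGC_Suc: "m \<ge> 1 \<Longrightarrow> BRGC (Suc m) = reflect_labeling (BRGC m)"
  by (cases m) (auto simp: BRGC_def)

lemma labeling_BRGC:
  assumes "m \<ge> 1"
  shows "labeling m (BRGC m)"
  using assms
proof (induction m rule: nat_induct_at_least)
  case base
  show ?case
    using labeling_NBC[of 1] by (simp only: BRGC_1_eq_NBC_1)
qed (simp add: BRGC_Suc labeling_reflect)

lemma labeling_FBC:
  assumes "m \<ge> 1"
  shows "labeling m (FBC m)"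
  using labeling_reflect[OF labeling_NBC[of "m - 1"]] assms by (simp add: FBC_def)

text \<open>Adding the last bit to the first is an involution on words of length \<open>m\<close>:
  from order 2 on, the last bit is not the one being changed.\<close>

lemma labeling_BSGC:
  assumes "m \<ge> 2"
  shows "labeling m (BSGC m)"
proof -
  let ?f = "\<lambda>c. (hd c \<noteq> last c) # tl c"
  let ?A = "{c :: bool list. length c = m}"
  have invol: "?f (?f c) = c" and len: "?f c \<in> ?A" if "c \<in> ?A" for c
    using that assms by (cases c; cases "tl c"; auto)+
  have "inj_on ?f ?A"
    by (rule inj_on_inverseI[of _ ?f]) (rule invol)
  moreover have "?f ` ?A = ?A"
  proof
    show "?A \<subseteq> ?f ` ?A"
      using invol len by (metis (no_types, lifting) image_eqI subsetI)
  qed (use len in blast)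
  moreover have "distinct (BRGC m)" "set (BRGC m) = ?A"
    using labeling_BRGC[of m] assms by (simp_all add: labeling_def)
  ultimately show ?thesis
    unfolding labeling_def BSGC_def distinct_map set_map by simp
qed

section \<open>Rows of the codes as modulo-2 sums of digits of the row index\<close>

lemma bit_complement:
  fixes i :: nat
  assumes "i < 2 ^ m" "j < m"
  shows "bit (2 ^ m - 1 - i) j \<longleftrightarrow> \<not> bit i j"
proof -
  \<comment> \<open>\<open>- i - 1\<close> is the bitwise complement of \<open>i\<close> in two's
    complement, and \<open>take_bit m\<close> brings it back into the range of indices.\<close>
  have "int (2 ^ m - 1 - i) = take_bit m (- int i - 1)"
    using assms take_bit_not_eq_mask_diff[of m "int i"]
    by (simp add: not_eq_complement mask_eq_exp_minus_1 take_bit_int_eq_self of_nat_diff)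
  then have "bit (int (2 ^ m - 1 - i)) j \<longleftrightarrow> \<not> bit (int i) j"
    using assms by (simp add: bit_take_bit_iff bit_not_iff flip: not_eq_complement)
  then show ?thesis
    by (simp add: bit_of_nat_iff_bit)
qed

lemma bit_top:
  fixes i :: nat
  assumes "i < 2 ^ Suc m"
  shows "bit i m \<longleftrightarrow> 2 ^ m \<le> i"
proof (cases "2 ^ m \<le> i")
  case True
  then have "i div 2 ^ m = 1"
    using assms by (intro div_nat_eqI) auto
  with True show ?thesis
    by (simp add: bit_iff_odd)
qed (auto simp: bit_iff_odd)

lemma bit_add_exp:
  fixes i :: nat
  assumes "j < m"
  shows "bit (i + 2 ^ m) j \<longleftrightarrow> bit i j"
proof -
  have "(2::nat) ^ m = 2 ^ j * 2 ^ (m - j)"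
    using assms by (simp flip: power_add)
  then have "(i + 2 ^ m) div 2 ^ j = i div 2 ^ j + 2 ^ (m - j)"
    by simp
  then show ?thesis
    using assms by (simp add: bit_iff_odd)
qed

text \<open>The classical form \<open>i xor (i div 2)\<close> of the Gray code. A reflection
  replaces the index by its complement, and flipping all digits leaves the sum of two adjacent
  digits unchanged.\<close>

lemma BRGC_bit:
  assumes "m \<ge> 1" "i < 2 ^ m" "k < m"
  shows "BRGC m ! i ! k = (bit i (m - 1 - k) \<noteq> (k > 0 \<and> bit i (m - k)))"
  using assms
proof (induction m arbitrary: i k rule: nat_induct_at_least)
  case base
  then show ?case
    by (simp only: BRGC_1_eq_NBC_1) (simp add: nth_NBC)
next
  case (Suc m)
  have len: "length (BRGC m) = 2 ^ m"
    using Suc.hyps by (intro labeling_length labeling_BRGC)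
  note nth = nth_reflect_labeling[of i "BRGC m", unfolded len]
  show ?case
  proof (cases k)
    case 0
    then show ?thesis
      using Suc.prems nth Suc.hyps by (simp add: BRGC_Suc bit_top)
  next
    case (Suc l)
    have l: "l < m"
      using Suc Suc.prems by simp
    show ?thesis
    proof (cases "i < 2 ^ m")
      case True
      then have "\<not> bit i m"
        using bit_top[of i m] by simp
      with True show ?thesis
        using Suc.IH[of i l] Suc l nth Suc.hyps by (auto simp: BRGC_Suc)
    next
      case False
      then have i: "bit i m" "2 ^ Suc m - 1 - i < 2 ^ m"
        using bit_top[of i m] Suc.prems by auto
      have "\<not> bit (2 ^ Suc m - 1 - i) m"
        using i bit_complement[of i "Suc m" m] Suc.prems by simp
      \<comment> \<open>For \<open>l > 0\<close> the two flips cancel. For \<open>l = 0\<close> the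
        induction hypothesis has a single flipped digit, and this flip is exactly the contribution
        of the new top digit, which is 1 here.\<close>
      then show ?thesis
        using Suc.IH[of "2 ^ Suc m - 1 - i" l] Suc l nth i False Suc.hyps Suc.prems
          bit_complement[of i "Suc m"]
        by (cases l) (auto simp: BRGC_Suc)
    qed
  qed
qed

text \<open>The outer reflection complements the index in the upper half, so the top digit is added
  to every digit below it.\<close>

lemma FBC_bit:
  assumes "m \<ge> 1" "i < 2 ^ m" "k < m"
  shows "FBC m ! i ! k = (bit i (m - 1) \<noteq> (k > 0 \<and> bit i (m - 1 - k)))"
proof -
  obtain n where m: "m = Suc n"
    using assms(1) by (cases m) auto
  have len: "length (NBC n) = 2 ^ n"
    by (simp add: NBC_def)
  note nth = nth_reflect_labeling[of i "NBC n", unfolded len]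
  show ?thesis
  proof (cases "i < 2 ^ n")
    case True
    then show ?thesis
      using nth assms bit_top[of i n] by (cases k) (auto simp: m FBC_def nth_NBC)
  next
    case False
    then have "2 ^ Suc n - 1 - i < 2 ^ n" "bit i n"
      using assms bit_top[of i n] by (auto simp: m)
    then show ?thesis
      using nth assms False bit_complement[of i "Suc n"]
      by (cases k) (auto simp: m FBC_def nth_NBC)
  qed
qed

lemma BSGC_bit:
  assumes "m \<ge> 2" "i < 2 ^ m" "k < m"
  shows "BSGC m ! i ! k = (BRGC m ! i ! k \<noteq> (k = 0 \<and> BRGC m ! i ! (m - 1)))"
proof -
  have "length (BRGC m) = 2 ^ m"
    using assms by (intro labeling_length labeling_BRGC) simp
  moreover from this have "length (BRGC m ! i) = m"
    using labeling_BRGC[of m] assms nth_mem[of i "BRGC m"] by (simp add: labeling_def)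
  ultimately show ?thesis
    using assms by (cases "BRGC m ! i"; cases k) (auto simp: BSGC_def last_conv_nth)
qed

section \<open>Columns of labelings as Walsh functions\<close>

abbreviation bsign :: "bool \<Rightarrow> real" where
  "bsign b \<equiv> if b then - 1 else 1"

text \<open>\<open>bsign\<close> turns modulo-2 sums into products, so a column that is the sum of
  the digits in positions \<open>E\<close> has this sign pattern. Position 0 is the least
  significant digit.\<close>

definition walsh :: "nat set \<Rightarrow> nat \<Rightarrow> real" where
  "walsh E i = (\<Prod>j\<in>E. bsign (bit i j))"

text \<open>Both the sign and \<open>w ^ i\<close> are products over the binary digits of
  \<open>i\<close>, so the sum over all digit patterns is a product of sums over one digit. The
  induction splits off the top digit.\<close>

lemma sum_walsh_power:
  fixes w :: complex
  shows "(\<Sum>i<2 ^ m. of_real (walsh (E \<inter> {..<m}) i) * w ^ i) =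
    (\<Prod>j<m. 1 + of_real (bsign (j \<in> E)) * w ^ (2 ^ j))"
proof (induction m)
  case 0
  show ?case
    by (simp add: walsh_def)
next
  case (Suc m)
  let ?W = "\<lambda>m i. of_real (walsh (E \<inter> {..<m}) i) :: complex"
  have E: "E \<inter> {..<Suc m} = (if m \<in> E then insert m (E \<inter> {..<m}) else E \<inter> {..<m})"
    by (auto simp: less_Suc_eq)
  have low: "?W (Suc m) i = ?W m i" if "i < 2 ^ m" for i
    using that bit_top[of i m] by (simp add: E walsh_def)
  have high: "?W (Suc m) (i + 2 ^ m) = of_real (bsign (m \<in> E)) * ?W m i" if "i < 2 ^ m" for i
    using that bit_top[of "i + 2 ^ m" m] by (auto simp: E walsh_def bit_add_exp intro!: prod.cong)
  have "(\<Sum>i<2 ^ Suc m. ?W (Suc m) i * w ^ i) =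
      (\<Sum>i=0..<2 ^ m. ?W (Suc m) i * w ^ i) + (\<Sum>i=2 ^ m..<2 ^ m + 2 ^ m. ?W (Suc m) i * w ^ i)"
    by (subst sum.atLeastLessThan_concat) (auto simp: atLeast0LessThan mult_2)
  also have "(\<Sum>i=2 ^ m..<2 ^ m + 2 ^ m. ?W (Suc m) i * w ^ i) =
      (\<Sum>i=0..<2 ^ m. ?W (Suc m) (i + 2 ^ m) * w ^ (i + 2 ^ m))"
    using sum.shift_bounds_nat_ivl[of "\<lambda>i. ?W (Suc m) i * w ^ i" 0 "2 ^ m" "2 ^ m"] by simp
  also have "\<dots> = of_real (bsign (m \<in> E)) * w ^ (2 ^ m) * (\<Sum>i=0..<2 ^ m. ?W m i * w ^ i)"
    unfolding sum_distrib_left by (intro sum.cong) (auto simp: high power_add algebra_simps)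
  also have "(\<Sum>i=0..<2 ^ m. ?W (Suc m) i * w ^ i) = (\<Sum>i=0..<2 ^ m. ?W m i * w ^ i)"
    by (intro sum.cong) (auto simp: low)
  finally have "(\<Sum>i<2 ^ Suc m. ?W (Suc m) i * w ^ i) =
      (\<Sum>i<2 ^ m. ?W m i * w ^ i) * (1 + of_real (bsign (m \<in> E)) * w ^ (2 ^ m))"
    by (simp only: atLeast0LessThan distrib_left mult_1_right) (simp only: mult_ac)
  then show ?case
    by (simp only: Suc.IH prod.lessThan_Suc)
qed

lemma norm_one_plus_cis: "(cmod (1 + cis (2 * t)))\<^sup>2 = 4 * (cos t)\<^sup>2"
  and norm_one_minus_cis: "(cmod (1 - cis (2 * t)))\<^sup>2 = 4 * (sin t)\<^sup>2"
proof -
  have "(cmod (1 + cis (2 * t)))\<^sup>2 = 2 + 2 * cos (2 * t)"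
    "(cmod (1 - cis (2 * t)))\<^sup>2 = 2 - 2 * cos (2 * t)"
    using sin_cos_squared_add[of "2 * t"] by (simp_all add: cmod_power2 power2_sum power2_diff)
  then show "(cmod (1 + cis (2 * t)))\<^sup>2 = 4 * (cos t)\<^sup>2"
    "(cmod (1 - cis (2 * t)))\<^sup>2 = 4 * (sin t)\<^sup>2"
    using cos_double_cos[of t] cos_double_sin[of t] by simp_all
qed

text \<open>With the plane read as the complex numbers, \<open>psk M i\<close> is a power of the
  primitive root of unity times \<open>cis (pi / M)\<close>; this common rotation does not affect
  the norm.\<close>

lemma norm_sum_psk:
  "(norm (\<Sum>i\<in>I. a i *\<^sub>R psk M i))\<^sup>2 =
    (cmod (\<Sum>i\<in>I. of_real (a i) * cis (2 * (pi / M)) ^ i))\<^sup>2"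
proof -
  let ?s = "\<Sum>i\<in>I. of_real (a i) * cis ((2 * real i + 1) * pi / M)"
  have "(norm (\<Sum>i\<in>I. a i *\<^sub>R psk M i))\<^sup>2 = (cmod ?s)\<^sup>2"
    by (simp add: norm_vec_def L2_set_def UNIV_2 psk_def cmod_power2 sum_nonneg)
  also have "?s = cis (pi / M) * (\<Sum>i\<in>I. of_real (a i) * cis (2 * (pi / M)) ^ i)"
    unfolding sum_distrib_left
    by (intro sum.cong) (auto simp: Complex.DeMoivre cis_mult algebra_simps add_divide_distrib)
  finally show ?thesis
    by (simp add: norm_mult)
qed

lemma norm_sum_walsh_psk:
  assumes "E \<subseteq> {..<m}"
  shows "(norm (\<Sum>i<2 ^ m. walsh E i *\<^sub>R psk (2 ^ m) i))\<^sup>2 =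
    (\<Prod>j<m. 4 * (if j \<in> E then sin else cos) (2 ^ j * (pi / 2 ^ m)) ^ 2)"
proof -
  let ?w = "cis (2 * (pi / 2 ^ m))"
  have "(cmod (1 + of_real (bsign (j \<in> E)) * ?w ^ (2 ^ j)))\<^sup>2 =
      4 * (if j \<in> E then sin else cos) (2 ^ j * (pi / 2 ^ m)) ^ 2" for j
    using norm_one_plus_cis[of "2 ^ j * (pi / 2 ^ m)"] norm_one_minus_cis[of "2 ^ j * (pi / 2 ^ m)"]
    by (auto simp: Complex.DeMoivre mult_ac)
  then show ?thesis
    using sum_walsh_power[of E m ?w] assms
    by (simp add: norm_sum_psk Int_absorb2 prod_norm[symmetric] prod_power_distrib)
qed

text \<open>The leading factor starts the chain: with \<open>4 * (cos t)\<^sup>2\<close> it becomes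
  the squared sine of \<open>2 * t\<close>, which meets the next factor, and so on.\<close>

lemma prod_cos_double: "(sin (t::real))\<^sup>2 * (\<Prod>j<n. 4 * (cos (2 ^ j * t))\<^sup>2) = (sin (2 ^ n * t))\<^sup>2"
proof (induction n)
  case (Suc n)
  have "(sin t)\<^sup>2 * (\<Prod>j<Suc n. 4 * (cos (2 ^ j * t))\<^sup>2) =
      (sin (2 ^ n * t))\<^sup>2 * (4 * (cos (2 ^ n * t))\<^sup>2)"
    by (simp add: mult.assoc flip: Suc.IH)
  also have "\<dots> = (sin (2 * (2 ^ n * t)))\<^sup>2"
    by (simp add: sin_double power_mult_distrib)
  finally show ?case
    by (simp add: mult_ac)
qed simp

text \<open>Without the top digit the sign has period \<open>2 ^ (m - 1)\<close>, so antipodal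
  points carry equal signs and cancel. In the product this is the factor with
  \<open>cos (pi / 2)\<close>.\<close>

lemma norm_sum_walsh_psk_0:
  assumes "m \<ge> 1" "E \<subseteq> {..<m - 1}"
  shows "(norm (\<Sum>i<2 ^ m. walsh E i *\<^sub>R psk (2 ^ m) i))\<^sup>2 = 0"
proof -
  obtain n where m: "m = Suc n"
    using assms(1) by (cases m) auto
  have "n \<notin> E" "E \<subseteq> {..<m}" "2 ^ n * (pi / 2 ^ m) = pi / 2"
    using assms by (auto simp: m)
  then show ?thesis
    using norm_sum_walsh_psk[of E m] by (simp add: m)
qed

text \<open>The top digit contributes \<open>4 * (sin (pi / 2))\<^sup>2 = 4\<close>. If all lower
  factors were cosines they would telescope to the inverse squared sine; each digit in
  \<open>E\<close> exchanges a cosine for a sine, that is, inserts a squared tangent.\<close>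

lemma norm_sum_walsh_psk_insert:
  assumes "m \<ge> 1" "E \<subseteq> {..<m - 1}"
  shows "(norm (\<Sum>i<2 ^ m. walsh (insert (m - 1) E) i *\<^sub>R psk (2 ^ m) i))\<^sup>2 =
    4 / (sin (pi / 2 ^ m))\<^sup>2 * (\<Prod>j\<in>E. (tan (2 ^ j * (pi / 2 ^ m)))\<^sup>2)"
proof -
  obtain n where m: "m = Suc n"
    using assms(1) by (cases m) auto
  define t where "t = pi / 2 ^ m"
  have E: "E \<subseteq> {..<n}" "insert n E \<subseteq> {..<m}"
    using assms by (auto simp: m)
  have half: "2 ^ n * t = pi / 2"
    by (simp add: t_def m)
  have t: "0 < t" "t < pi"
    using one_le_power[of "2 :: real" n] by (simp_all add: t_def m divide_less_eq del: one_le_power)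
  \<comment> \<open>Only the top angle reaches \<open>pi / 2\<close>; the lower ones stay strictly
    below it, which permits the division by cosines.\<close>
  have cos: "cos (2 ^ j * t) \<noteq> 0" if "j < n" for j
  proof -
    have "2 ^ j * t < 2 ^ n * t"
      using that t by (intro mult_strict_right_mono) auto
    then have "0 < cos (2 ^ j * t)"
      using t half by (intro cos_gt_zero) auto
    then show ?thesis by simp
  qed
  have "(norm (\<Sum>i<2 ^ m. walsh (insert (m - 1) E) i *\<^sub>R psk (2 ^ m) i))\<^sup>2 =
      (\<Prod>j<n. 4 * (if j \<in> E then sin else cos) (2 ^ j * t) ^ 2) * 4"
    using norm_sum_walsh_psk[OF E(2)] half unfolding t_def[symmetric]
    by (auto simp: m if_distribR intro!: prod.cong)
  also have "(\<Prod>j<n. 4 * (if j \<in> E then sin else cos) (2 ^ j * t) ^ 2) =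
      (\<Prod>j<n. 4 * (cos (2 ^ j * t))\<^sup>2 * (if j \<in> E then (tan (2 ^ j * t))\<^sup>2 else 1))"
    by (intro prod.cong) (auto simp: tan_def cos power_divide)
  also have "\<dots> = (\<Prod>j<n. 4 * (cos (2 ^ j * t))\<^sup>2) * (\<Prod>j\<in>E. (tan (2 ^ j * t))\<^sup>2)"
    using E(1) prod.inter_restrict[of "{..<n}" "\<lambda>j. (tan (2 ^ j * t))\<^sup>2" E]
    by (simp add: prod.distrib Int_absorb1)
  also have "(\<Prod>j<n. 4 * (cos (2 ^ j * t))\<^sup>2) = 1 / (sin t)\<^sup>2"
    using prod_cos_double[of t n, unfolded half] sin_gt_zero[OF t] by (simp add: field_simps)
  finally show ?thesis
    by (simp add: t_def)
qed

text \<open>Divided by \<open>2 ^ m\<close>, for a labeling and \<open>k < m\<close>, this is half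
  the difference between the mean symbol given bit 0 and the mean symbol given bit 1 in position
  \<open>k\<close>.\<close>

definition column_sum :: "nat \<Rightarrow> (nat \<Rightarrow> real ^ 'n) \<Rightarrow> bool list list \<Rightarrow> nat \<Rightarrow> real ^ 'n" where
  "column_sum m x L k = (\<Sum>i<2 ^ m. bsign (L ! i ! k) *\<^sub>R x i)"

lemma column_sum_walsh:
  assumes "\<And>i. i < 2 ^ m \<Longrightarrow> bsign (L ! i ! k) = walsh E i"
  shows "column_sum m x L k = (\<Sum>i<2 ^ m. walsh E i *\<^sub>R x i)"
  unfolding column_sum_def using assms by (intro sum.cong) simp_all

section \<open>Column sums of the four codes on PSK\<close>

lemma column_sums_NBC:
  assumes "m \<ge> 1"
  shows "(\<Sum>k<m. (norm (column_sum m (psk (2 ^ m)) (NBC m) k))\<^sup>2) = 4 / (sin (pi / 2 ^ m))\<^sup>2"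
proof -
  have col: "column_sum m (psk (2 ^ m)) (NBC m) k =
      (\<Sum>i<2 ^ m. walsh {m - 1 - k} i *\<^sub>R psk (2 ^ m) i)" if "k < m" for k
    using that by (intro column_sum_walsh) (simp add: nth_NBC walsh_def)
  \<comment> \<open>Column \<open>k\<close> is the single digit \<open>m - 1 - k\<close>, so only
    column 0 contains the top digit.\<close>
  have "(\<Sum>k<m. (norm (column_sum m (psk (2 ^ m)) (NBC m) k))\<^sup>2) =
      (\<Sum>k<m. if k = 0 then 4 / (sin (pi / 2 ^ m))\<^sup>2 else 0)"
  proof (intro sum.cong refl)
    fix k
    assume "k \<in> {..<m}"
    then show "(norm (column_sum m (psk (2 ^ m)) (NBC m) k))\<^sup>2 =
        (if k = 0 then 4 / (sin (pi / 2 ^ m))\<^sup>2 else 0)"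
      using norm_sum_walsh_psk_insert[of m "{}"] norm_sum_walsh_psk_0[of m "{m - 1 - k}"]
      by (auto simp: col)
  qed
  then show ?thesis
    using assms by simp
qed

text \<open>The top digit occurs only in columns 0 and 1. Column 1 also contains the digit below it,
  whose factor is the squared tangent of \<open>pi / 4\<close>, hence 1.\<close>

lemma column_sum_BRGC_psk:
  assumes "m \<ge> 2" "k < m"
  shows "(norm (column_sum m (psk (2 ^ m)) (BRGC m) k))\<^sup>2 =
    (if k \<le> 1 then 4 / (sin (pi / 2 ^ m))\<^sup>2 else 0)"
proof (cases "k = 0")
  case True
  then have "column_sum m (psk (2 ^ m)) (BRGC m) k = (\<Sum>i<2 ^ m. walsh {m - 1} i *\<^sub>R psk (2 ^ m) i)"
    using assms by (intro column_sum_walsh) (simp add: BRGC_bit walsh_def)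
  then show ?thesis
    using norm_sum_walsh_psk_insert[of m "{}"] assms True by simp
next
  case False
  then have col: "column_sum m (psk (2 ^ m)) (BRGC m) k =
      (\<Sum>i<2 ^ m. walsh {m - k, m - 1 - k} i *\<^sub>R psk (2 ^ m) i)"
    using assms by (intro column_sum_walsh) (auto simp: BRGC_bit walsh_def)
  show ?thesis
  proof (cases "k = 1")
    case True
    have eq: "{m - k, m - 1 - k} = insert (m - 1) {m - 2}" and sub: "{m - 2} \<subseteq> {..<m - 1}"
      using assms True by auto
    have "(norm (column_sum m (psk (2 ^ m)) (BRGC m) k))\<^sup>2 =
        4 / (sin (pi / 2 ^ m))\<^sup>2 * (tan (2 ^ (m - 2) * (pi / 2 ^ m)))\<^sup>2"
      unfolding col eq using norm_sum_walsh_psk_insert[OF _ sub] assms by simp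
    also have "2 ^ (m - 2) * (pi / 2 ^ m) = pi / 4"
      using assms by (simp add: power_diff)
    finally show ?thesis
      using True by (simp add: tan_45)
  next
    case False
    then have "{m - k, m - 1 - k} \<subseteq> {..<m - 1}"
      using assms \<open>k \<noteq> 0\<close> by auto
    then show ?thesis
      using norm_sum_walsh_psk_0[of m "{m - k, m - 1 - k}"] assms \<open>k \<noteq> 0\<close> False by (simp add: col)
  qed
qed

text \<open>Two equal contributions, hence twice the value for the natural binary code. At order 1
  there is no column 1, and the sum is only half as large.\<close>

lemma column_sums_BRGC:
  assumes "m \<ge> 2"
  shows "(\<Sum>k<m. (norm (column_sum m (psk (2 ^ m)) (BRGC m) k))\<^sup>2) = 8 / (sin (pi / 2 ^ m))\<^sup>2"
proof -
  have "(\<Sum>k<m. (norm (column_sum m (psk (2 ^ m)) (BRGC m) k))\<^sup>2) =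
      (\<Sum>k<m. if k \<in> {0, 1} then 4 / (sin (pi / 2 ^ m))\<^sup>2 else 0)"
    using assms by (intro sum.cong) (auto simp: column_sum_BRGC_psk)
  also have "\<dots> = (\<Sum>k\<in>{0, 1 :: nat}. 4 / (sin (pi / 2 ^ m))\<^sup>2)"
    using assms by (intro sum.mono_neutral_cong_right) auto
  finally show ?thesis
    by simp
qed

text \<open>The last Gray column is the sum of digits 0 and 1, so the new first column has digits
  \<open>m - 1\<close>, 0 and 1, which are distinct from order 3 on. The secant arises from
  \<open>tan t * tan (2 * t) = 1 / cos (2 * t) - 1\<close>. The other columns are those of the Gray
  code.\<close>

lemma column_sums_BSGC:
  assumes "m \<ge> 3"
  shows "(\<Sum>k<m. (norm (column_sum m (psk (2 ^ m)) (BSGC m) k))\<^sup>2) =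
    4 / (sin (pi / 2 ^ m))\<^sup>2 * (1 + (1 - 1 / cos (2 * pi / 2 ^ m))\<^sup>2)"
proof -
  define t where "t = pi / 2 ^ m"
  have "(2::real) ^ 3 \<le> 2 ^ m"
    using assms by (intro power_increasing) auto
  then have t: "0 < t" "2 * t < pi / 2"
    by (simp_all add: t_def field_simps)
  then have cos: "cos t > 0" "cos (2 * t) > 0"
    by (simp_all add: cos_gt_zero)
  have "column_sum m (psk (2 ^ m)) (BSGC m) 0 =
      (\<Sum>i<2 ^ m. walsh (insert (m - 1) {0, 1}) i *\<^sub>R psk (2 ^ m) i)"
    using assms by (intro column_sum_walsh) (auto simp: BSGC_bit BRGC_bit walsh_def)
  then have "(norm (column_sum m (psk (2 ^ m)) (BSGC m) 0))\<^sup>2 = 4 / (sin t)\<^sup>2 * ((tan t)\<^sup>2 * (tan (2 * t))\<^sup>2)"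
    using norm_sum_walsh_psk_insert[of m "{0, 1}"] assms by (simp add: t_def)
  also have "tan t * tan (2 * t) = - (1 - 1 / cos (2 * t))"
  proof -
    have "tan t * tan (2 * t) = 2 * (sin t)\<^sup>2 / cos (2 * t)"
      using cos(1) by (simp add: tan_def sin_double power2_eq_square)
    also have "2 * (sin t)\<^sup>2 = 1 - cos (2 * t)"
      by (simp add: cos_double_sin)
    finally show ?thesis
      using cos(2) by (simp add: diff_divide_distrib)
  qed
  then have "(tan t)\<^sup>2 * (tan (2 * t))\<^sup>2 = (1 - 1 / cos (2 * t))\<^sup>2"
    by (simp only: power_mult_distrib[symmetric] power2_minus)
  finally have first: "(norm (column_sum m (psk (2 ^ m)) (BSGC m) 0))\<^sup>2 =
    4 / (sin t)\<^sup>2 * (1 - 1 / cos (2 * t))\<^sup>2" .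
  have "(norm (column_sum m (psk (2 ^ m)) (BSGC m) k))\<^sup>2 = (if k = 1 then 4 / (sin t)\<^sup>2 else 0)"
    if "k < m" "k \<noteq> 0" for k
  proof -
    have "column_sum m (psk (2 ^ m)) (BSGC m) k = column_sum m (psk (2 ^ m)) (BRGC m) k"
      using assms that by (auto simp: column_sum_def BSGC_bit intro!: sum.cong)
    then show ?thesis
      using column_sum_BRGC_psk[of m k] assms that by (simp add: t_def)
  qed
  then have "(\<Sum>k<m. (norm (column_sum m (psk (2 ^ m)) (BSGC m) k))\<^sup>2) =
      (\<Sum>k<m. (if k = 0 then 4 / (sin t)\<^sup>2 * (1 - 1 / cos (2 * t))\<^sup>2 else 0)
        + (if k = 1 then 4 / (sin t)\<^sup>2 else 0))"
    using first by (intro sum.cong) auto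
  also have "\<dots> = 4 / (sin t)\<^sup>2 * (1 - 1 / cos (2 * t))\<^sup>2 + 4 / (sin t)\<^sup>2"
    using assms by (simp add: sum.distrib)
  finally show ?thesis
    by (simp add: t_def algebra_simps)
qed

text \<open>Here every column contains the top digit. For \<open>k > 0\<close> the second digit
  \<open>m - 1 - k\<close> has angle \<open>pi / 2 ^ Suc k\<close>, which shifts the range of the
  tangent sum to start at 2.\<close>

lemma column_sums_FBC:
  assumes "m \<ge> 2"
  shows "(\<Sum>k<m. (norm (column_sum m (psk (2 ^ m)) (FBC m) k))\<^sup>2) =
    4 / (sin (pi / 2 ^ m))\<^sup>2 * (1 + (\<Sum>k=2..m. (tan (pi / 2 ^ k))\<^sup>2))"
proof -
  let ?f = "\<lambda>k. (norm (column_sum m (psk (2 ^ m)) (FBC m) k))\<^sup>2"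
  have "column_sum m (psk (2 ^ m)) (FBC m) 0 = (\<Sum>i<2 ^ m. walsh {m - 1} i *\<^sub>R psk (2 ^ m) i)"
    using assms by (intro column_sum_walsh) (simp add: FBC_bit walsh_def)
  then have first: "?f 0 = 4 / (sin (pi / 2 ^ m))\<^sup>2"
    using norm_sum_walsh_psk_insert[of m "{}"] assms by simp
  have rest: "?f k = 4 / (sin (pi / 2 ^ m))\<^sup>2 * (tan (pi / 2 ^ Suc k))\<^sup>2" if "k \<in> {1..<m}" for k
  proof -
    have "column_sum m (psk (2 ^ m)) (FBC m) k =
        (\<Sum>i<2 ^ m. walsh (insert (m - 1) {m - 1 - k}) i *\<^sub>R psk (2 ^ m) i)"
      using assms that by (intro column_sum_walsh) (auto simp: FBC_bit walsh_def)
    moreover have "2 ^ (m - 1 - k) * (pi / 2 ^ m) = pi / 2 ^ Suc k"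
      using that by (simp add: power_diff field_simps flip: power_Suc)
    moreover have "{m - 1 - k} \<subseteq> {..<m - 1}"
      using that by auto
    ultimately show ?thesis
      using norm_sum_walsh_psk_insert[of m "{m - 1 - k}"] assms by simp
  qed
  have "(\<Sum>k<m. ?f k) = ?f 0 + (\<Sum>k=1..<m. ?f k)"
    using assms by (simp add: sum.atLeast_Suc_lessThan flip: atLeast0LessThan)
  also have "(\<Sum>k=1..<m. ?f k) = 4 / (sin (pi / 2 ^ m))\<^sup>2 * (\<Sum>k=1..<m. (tan (pi / 2 ^ Suc k))\<^sup>2)"
    unfolding sum_distrib_left by (intro sum.cong refl rest)
  also have "(\<Sum>k=1..<m. (tan (pi / 2 ^ Suc k))\<^sup>2) = (\<Sum>k=2..m. (tan (pi / 2 ^ k))\<^sup>2)"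
    using sum.shift_bounds_Suc_ivl[of "\<lambda>k. (tan (pi / 2 ^ k))\<^sup>2" 1 m]
    by (simp add: numeral_2_eq_2 atLeastLessThanSuc_atLeastAtMost)
  finally show ?thesis
    using first by (simp add: algebra_simps)
qed

section \<open>Elementary inequalities\<close>

text \<open>The inequality \<open>ln y \<le> y - 1\<close> at \<open>1 / x\<close> and at
  \<open>x\<close>. The two bounds dominate \<open>x * ln x\<close> by moments of order at most
  two.\<close>

lemma x_ln_x_bounds:
  fixes x :: real
  assumes "x > 0"
  shows "x - 1 \<le> x * ln x" and "x * ln x \<le> x\<^sup>2 - x"
proof -
  have "ln (1 / x) \<le> 1 / x - 1"
    using assms by (intro ln_le_minus_one) simp
  then show "x - 1 \<le> x * ln x"
    using assms by (simp add: ln_div field_simps)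
  show "x * ln x \<le> x\<^sup>2 - x"
    using assms mult_left_mono[OF ln_le_minus_one[OF assms], of x]
    by (simp add: algebra_simps power2_eq_square)
qed

lemma minimum_at_1:
  fixes f f' :: "real \<Rightarrow> real"
  assumes f: "\<And>x. x > 0 \<Longrightarrow> (f has_real_derivative f' x) (at x)"
    and neg: "\<And>x. 0 < x \<Longrightarrow> x \<le> 1 \<Longrightarrow> f' x \<le> 0"
    and pos: "\<And>x. 1 \<le> x \<Longrightarrow> f' x \<ge> 0"
    and x: "x > 0"
  shows "f 1 \<le> f x"
proof (cases "x \<le> 1")
  case True
  show ?thesis
  proof (rule DERIV_nonpos_imp_nonincreasing[OF True])
    fix y
    assume "x \<le> y" "y \<le> 1"
    then show "\<exists>D. (f has_real_derivative D) (at y) \<and> D \<le> 0"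
      using f[of y] neg[of y] x by (intro exI[of _ "f' y"]) auto
  qed
next
  case False
  then have "1 \<le> x" by simp
  then show ?thesis
  proof (rule DERIV_nonneg_imp_nondecreasing)
    fix y
    assume "1 \<le> y" "y \<le> x"
    then show "\<exists>D. (f has_real_derivative D) (at y) \<and> 0 \<le> D"
      using f[of y] pos[of y] by (intro exI[of _ "f' y"]) auto
  qed
qed

text \<open>The cubic Taylor polynomial at 1, with a remainder bound valid on the whole half-line,
  since likelihood ratios are unbounded. After division by \<open>x\<close>, each difference has a
  derivative that is \<open>(x - 1) ^ 3\<close> times a positive factor, so its minimum is at
  1.\<close>

lemma x_ln_x_Taylor:
  fixes x :: real
  assumes "x > 0"
  defines "g \<equiv> x - 1"
  shows "0 \<le> x * ln x - (g + g\<^sup>2 / 2 - g ^ 3 / 6)"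
    and "x * ln x - (g + g\<^sup>2 / 2 - g ^ 3 / 6) \<le> g ^ 4 / 3"
proof -
  have "ln 1 - (1 - 1 + (1 - 1)\<^sup>2 / 2 - (1 - 1) ^ 3 / 6) / 1 \<le>
      ln x - (x - 1 + (x - 1)\<^sup>2 / 2 - (x - 1) ^ 3 / 6) / x"
  proof (rule minimum_at_1[where f = "\<lambda>x. ln x - (x - 1 + (x - 1)\<^sup>2 / 2 - (x - 1) ^ 3 / 6) / x"
        and f' = "\<lambda>x. (x - 1) ^ 3 / (3 * x\<^sup>2)"])
    fix x :: real
    assume "x > 0"
    then show "((\<lambda>x. ln x - (x - 1 + (x - 1)\<^sup>2 / 2 - (x - 1) ^ 3 / 6) / x)
        has_real_derivative (x - 1) ^ 3 / (3 * x\<^sup>2)) (at x)"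
      by (auto intro!: derivative_eq_intros simp: field_simps power2_eq_square power3_eq_cube)
  qed (use assms in \<open>auto simp: divide_nonpos_pos power_le_zero_eq\<close>)
  then have "0 \<le> x * (ln x - (g + g\<^sup>2 / 2 - g ^ 3 / 6) / x)"
    using assms by (intro mult_nonneg_nonneg) auto
  then show "0 \<le> x * ln x - (g + g\<^sup>2 / 2 - g ^ 3 / 6)"
    using assms by (simp only: right_diff_distrib) simp
  have "((1 - 1) - (1 - 1)\<^sup>2 / 2 + (1 - 1) ^ 3 / 3) - ln 1 \<le>
      ((x - 1) - (x - 1)\<^sup>2 / 2 + (x - 1) ^ 3 / 3) - ln x"
  proof (rule minimum_at_1[where f = "\<lambda>x. ((x - 1) - (x - 1)\<^sup>2 / 2 + (x - 1) ^ 3 / 3) - ln x"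
        and f' = "\<lambda>x. (x - 1) ^ 3 / x"])
    fix x :: real
    assume "x > 0"
    then show "((\<lambda>x. ((x - 1) - (x - 1)\<^sup>2 / 2 + (x - 1) ^ 3 / 3) - ln x)
        has_real_derivative (x - 1) ^ 3 / x) (at x)"
      by (auto intro!: derivative_eq_intros simp: field_simps power2_eq_square power3_eq_cube)
  qed (use assms in \<open>auto simp: divide_nonpos_pos power_le_zero_eq\<close>)
  then have "x * ln x \<le> x * (g - g\<^sup>2 / 2 + g ^ 3 / 3)"
    using assms by (intro mult_left_mono) auto
  also have "\<dots> = (g + g\<^sup>2 / 2 - g ^ 3 / 6) + g ^ 4 / 3"
    by (simp add: g_def field_simps power2_eq_square power3_eq_cube power4_eq_xxxx)
  finally show "x * ln x - (g + g\<^sup>2 / 2 - g ^ 3 / 6) \<le> g ^ 4 / 3"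
    by simp
qed

lemma exp_Taylor_1:
  fixes t :: real
  assumes "\<bar>t\<bar> \<le> 1"
  shows "\<bar>exp t - 1 - t\<bar> \<le> t\<^sup>2"
proof (cases "t \<ge> 0")
  case True
  then show ?thesis
    using exp_bound[of t] exp_ge_add_one_self[of t] zero_le_power2[of t] assms
    unfolding abs_le_iff by linarith
next
  case False
  define s where "s = - t"
  have s: "s > 0"
    using False by (simp add: s_def)
  \<comment> \<open>Since \<open>exp t = 1 / exp s\<close>, an upper bound on \<open>exp t\<close>
    follows from a lower bound on \<open>exp s\<close>; the product of the two polynomials is 1 plus
    nonnegative terms.\<close>
  have "1 \<le> (1 + s + s\<^sup>2 / 2) * (1 - s + s\<^sup>2)"
    using s by (simp add: field_simps power2_eq_square)
  also have "\<dots> \<le> exp s * (1 - s + s\<^sup>2)"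
    using s exp_lower_Taylor_quadratic[of s] sum_power2_ge_zero[of "s - 1" 0]
    by (intro mult_right_mono) (auto simp: power2_eq_square algebra_simps)
  finally have "exp t \<le> 1 + t + t\<^sup>2"
    by (simp add: s_def exp_minus field_simps)
  then show ?thesis
    using exp_ge_add_one_self[of t] zero_le_power2[of t] unfolding abs_le_iff by linarith
qed

section \<open>Likelihood ratios of shifted Gaussian noise\<close>

text \<open>For \<open>N0 > 0\<close> this is the quotient of the noise density at
  \<open>z - d\<close> by the one at \<open>z\<close>, as \<open>noise_pdf_shift\<close>
  shows.\<close>

definition lik :: "real \<Rightarrow> real ^ 'n \<Rightarrow> real ^ 'n \<Rightarrow> real" where
  "lik N0 d z = exp ((2 * (d \<bullet> z) - d \<bullet> d) / N0)"

lemma lik_pos [simp]: "lik N0 d z > 0"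
  by (simp add: lik_def)

lemma lik_measurable [measurable]: "lik N0 d \<in> borel_measurable borel"
  unfolding lik_def by measurable

lemma noise_pdf_eq:
  fixes z :: "real ^ 'n"
  assumes "N0 > 0"
  shows "noise_pdf N0 z = (1 / sqrt (pi * N0)) ^ CARD('n) * exp (- (z \<bullet> z) / N0)"
proof -
  have "noise_pdf N0 z = (\<Prod>j\<in>UNIV. 1 / sqrt (pi * N0) * exp (- (z $ j * z $ j) / N0))"
    using assms by (simp add: noise_pdf_def normal_density_def power2_eq_square)
  also have "\<dots> = (1 / sqrt (pi * N0)) ^ CARD('n) * exp (\<Sum>j\<in>UNIV. - (z $ j * z $ j) / N0)"
    by (simp add: prod.distrib exp_sum power_one_over prod_dividef)
  also have "(\<Sum>j\<in>UNIV. - (z $ j * z $ j) / N0) = - (z \<bullet> z) / N0"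
    by (simp add: inner_vec_def sum_negf sum_divide_distrib)
  finally show ?thesis .
qed

lemma noise_pdf_shift:
  assumes "N0 > 0"
  shows "noise_pdf N0 (z - d) = noise_pdf N0 z * lik N0 d z"
proof -
  have "- ((z - d) \<bullet> (z - d)) / N0 = - (z \<bullet> z) / N0 + (2 * (d \<bullet> z) - d \<bullet> d) / N0"
    by (simp add: inner_diff inner_commute diff_divide_distrib add_divide_distrib)
  then have "exp (- ((z - d) \<bullet> (z - d)) / N0) = exp (- (z \<bullet> z) / N0) * lik N0 d z"
    by (simp only: exp_add lik_def)
  then show ?thesis
    using assms by (simp only: noise_pdf_eq mult.assoc)
qed

text \<open>The exponential supplies the cross term of the squared norm of \<open>d + e\<close>.
  Products of ratios are thus scaled ratios, and all their moments follow from the mean 1 of a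
  single ratio.\<close>

lemma lik_mult: "lik N0 d z * lik N0 e z = exp (2 * (d \<bullet> e) / N0) * lik N0 (d + e) z"
  by (simp add: lik_def inner_simps inner_commute add_divide_distrib diff_divide_distrib flip: exp_add)

lemma sets_noise [simp, measurable_cong]: "sets (noise N0) = sets borel"
  by (simp add: noise_def)

lemma space_noise [simp]: "space (noise N0) = UNIV"
  by (simp add: noise_def)

text \<open>Change of measure: averaging over the output for a fixed symbol becomes averaging over
  centred noise with weight \<open>lik\<close>, so that all symbols share one reference
  measure.\<close>

lemma integral_noise_shift:
  fixes F :: "real ^ 'n \<Rightarrow> real"
  assumes N0: "N0 > 0" and [measurable]: "F \<in> borel_measurable borel"
  shows "(\<integral>z. F (d + z) \<partial>noise N0) = (\<integral>z. F z * lik N0 d z \<partial>noise N0)"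
proof -
  have "(\<integral>z. F (d + z) \<partial>noise N0) = (\<integral>z. noise_pdf N0 z * F (d + z) \<partial>lborel)"
    unfolding noise_def by (subst integral_density) auto
  also have "\<dots> = (\<integral>z. (\<lambda>y. noise_pdf N0 (y - d) * F y) (d + z) \<partial>lborel)"
    by simp
  also have "\<dots> = (\<integral>y. noise_pdf N0 (y - d) * F y \<partial>distr lborel borel ((+) d))"
    by (subst integral_distr) auto
  also have "\<dots> = (\<integral>y. noise_pdf N0 y * (F y * lik N0 d y) \<partial>lborel)"
    by (simp add: lborel_distr_plus noise_pdf_shift[OF N0] mult_ac)
  also have "\<dots> = (\<integral>z. F z * lik N0 d z \<partial>noise N0)"
    unfolding noise_def by (subst integral_density) auto
  finally show ?thesis .
qed

lemma has_bochner_integral_lik: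
  assumes N0: "N0 > 0"
  shows "has_bochner_integral (noise N0) (lik N0 d) 1"
proof (rule has_bochner_integral_nn_integral)
  have "(\<integral>\<^sup>+z. ennreal (lik N0 d z) \<partial>noise N0) = (\<integral>\<^sup>+z. ennreal (noise_pdf N0 (z - d)) \<partial>lborel)"
    unfolding noise_def using N0
    by (subst nn_integral_density) (auto simp: noise_pdf_shift ennreal_mult less_imp_le)
  also have "\<dots> = 1"
    using nn_integral_lborel_translate[of "\<lambda>z. ennreal (noise_pdf N0 z)" "- d"]
    by (simp add: nn_integral_noise_pdf[OF N0])
  finally show "(\<integral>\<^sup>+z. ennreal (lik N0 d z) \<partial>noise N0) = ennreal 1"
    by simp
qed (auto simp: less_imp_le)

lemma has_bochner_integral_one_noise: "N0 > 0 \<Longrightarrow> has_bochner_integral (noise N0) (\<lambda>_. 1 :: real) 1"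
  using has_bochner_integral_lik[of N0 0] by (simp add: lik_def[abs_def])

lemma has_bochner_integral_lik_minus_1:
  assumes N0: "N0 > 0"
  shows "has_bochner_integral (noise N0) (\<lambda>z. lik N0 a z - 1) 0"
  using has_bochner_integral_diff[OF has_bochner_integral_lik[OF N0] has_bochner_integral_one_noise[OF N0]]
  by simp

lemma has_bochner_integral_lik_2:
  assumes N0: "N0 > 0"
  shows "has_bochner_integral (noise N0) (\<lambda>z. (lik N0 a z - 1) * (lik N0 b z - 1))
    (exp (2 * (a \<bullet> b) / N0) - 1)"
proof -
  note I = has_bochner_integral_lik[OF N0]
  note one = has_bochner_integral_one_noise[OF N0]
  have eq: "(lik N0 a z - 1) * (lik N0 b z - 1) =
      exp (2 * (a \<bullet> b) / N0) * lik N0 (a + b) z - lik N0 a z - lik N0 b z + 1" for z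
    using lik_mult[of N0 a z b] by (simp add: algebra_simps)
  have "has_bochner_integral (noise N0) (\<lambda>z. (lik N0 a z - 1) * (lik N0 b z - 1))
    (exp (2 * (a \<bullet> b) / N0) * 1 - 1 - 1 + 1)"
    unfolding eq by (intro has_bochner_integral_add has_bochner_integral_diff
      has_bochner_integral_mult_right I one)
  then show ?thesis by simp
qed

lemma has_bochner_integral_lik_3:
  assumes N0: "N0 > 0"
  shows "has_bochner_integral (noise N0) (\<lambda>z. (lik N0 a z - 1) * (lik N0 b z - 1) * (lik N0 c z - 1))
    (exp (2 * (a \<bullet> b + a \<bullet> c + b \<bullet> c) / N0) - exp (2 * (a \<bullet> b) / N0) - exp (2 * (a \<bullet> c) / N0)
      - exp (2 * (b \<bullet> c) / N0) + 2)"
proof -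
  note I = has_bochner_integral_lik[OF N0]
  note one = has_bochner_integral_one_noise[OF N0]
  have l3: "lik N0 a z * lik N0 b z * lik N0 c z =
      exp (2 * (a \<bullet> b + a \<bullet> c + b \<bullet> c) / N0) * lik N0 (a + b + c) z" for z
    by (simp add: lik_def inner_simps inner_commute add_divide_distrib diff_divide_distrib flip: exp_add)
  have eq: "(lik N0 a z - 1) * (lik N0 b z - 1) * (lik N0 c z - 1) =
      exp (2 * (a \<bullet> b + a \<bullet> c + b \<bullet> c) / N0) * lik N0 (a + b + c) z
      - exp (2 * (a \<bullet> b) / N0) * lik N0 (a + b) z - exp (2 * (a \<bullet> c) / N0) * lik N0 (a + c) z
      - exp (2 * (b \<bullet> c) / N0) * lik N0 (b + c) z + lik N0 a z + lik N0 b z + lik N0 c z - 1" for z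
    unfolding lik_mult[symmetric] l3[symmetric] by (simp add: algebra_simps)
  have "has_bochner_integral (noise N0) (\<lambda>z. (lik N0 a z - 1) * (lik N0 b z - 1) * (lik N0 c z - 1))
    (exp (2 * (a \<bullet> b + a \<bullet> c + b \<bullet> c) / N0) * 1 - exp (2 * (a \<bullet> b) / N0) * 1
      - exp (2 * (a \<bullet> c) / N0) * 1 - exp (2 * (b \<bullet> c) / N0) * 1 + 1 + 1 + 1 - 1)"
    unfolding eq by (intro has_bochner_integral_add has_bochner_integral_diff
      has_bochner_integral_mult_right I one)
  then show ?thesis
    by (rule back_subst[of "has_bochner_integral _ _"]) simp
qed

lemma has_bochner_integral_lik_4:
  assumes N0: "N0 > 0"
  shows "has_bochner_integral (noise N0) (\<lambda>z. (lik N0 a z - 1) ^ 4)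
    (exp (12 * (a \<bullet> a) / N0) - 4 * exp (6 * (a \<bullet> a) / N0) + 6 * exp (2 * (a \<bullet> a) / N0) - 3)"
proof -
  note I = has_bochner_integral_lik[OF N0]
  note one = has_bochner_integral_one_noise[OF N0]
  \<comment> \<open>The \<open>n\<close>-th power has the exponent \<open>n * (n - 1)\<close> times
    \<open>(a \<bullet> a) / N0\<close>, whence 12, 6 and 2.\<close>
  have powers: "lik N0 a z ^ 4 = exp (12 * (a \<bullet> a) / N0) * lik N0 (4 *\<^sub>R a) z"
    "lik N0 a z ^ 3 = exp (6 * (a \<bullet> a) / N0) * lik N0 (3 *\<^sub>R a) z"
    "lik N0 a z ^ 2 = exp (2 * (a \<bullet> a) / N0) * lik N0 (2 *\<^sub>R a) z" for z
    by (simp_all add: lik_def add_divide_distrib[symmetric] flip: exp_add exp_of_nat_mult)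
  have eq: "(lik N0 a z - 1) ^ 4 = lik N0 a z ^ 4 - 4 * lik N0 a z ^ 3 + 6 * lik N0 a z ^ 2
      - 4 * lik N0 a z + 1" for z
    by (simp add: field_simps power2_eq_square power3_eq_cube power4_eq_xxxx)
  have "has_bochner_integral (noise N0) (\<lambda>z. (lik N0 a z - 1) ^ 4)
    (exp (12 * (a \<bullet> a) / N0) * 1 - 4 * (exp (6 * (a \<bullet> a) / N0) * 1)
      + 6 * (exp (2 * (a \<bullet> a) / N0) * 1) - 4 * 1 + 1)"
    unfolding eq powers by (intro has_bochner_integral_add has_bochner_integral_diff
      has_bochner_integral_mult_right I one)
  then show ?thesis
    by (rule back_subst[of "has_bochner_integral _ _"]) simp
qed

section \<open>Finite mixtures of likelihood ratios and their entropy integrals\<close>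

locale shift_mixture =
  fixes N0 :: real and I :: "'i set" and w :: "'i \<Rightarrow> real" and d :: "'i \<Rightarrow> real ^ 'n"
  assumes N0: "N0 > 0" and finite: "finite I"
    and weight_nonneg: "\<And>i. i \<in> I \<Longrightarrow> 0 \<le> w i" and weight_sum: "sum w I = 1"
begin

text \<open>An output density divided by the noise density. The uniform weights and the weights
  given the value of one bit are the instances of interest.\<close>

definition mix :: "real ^ 'n \<Rightarrow> real" where
  "mix z = (\<Sum>i\<in>I. w i * lik N0 (d i) z)"

lemma mix_measurable [measurable]: "mix \<in> borel_measurable borel"
  unfolding mix_def[abs_def] by measurable

lemma weight_le_mix: "i \<in> I \<Longrightarrow> w i * lik N0 (d i) z \<le> mix z"
  unfolding mix_def
  by (rule member_le_sum[of i I "\<lambda>i. w i * lik N0 (d i) z"])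
    (auto simp: finite weight_nonneg less_imp_le)

lemma mix_pos: "mix z > 0"
proof -
  obtain i where i: "i \<in> I" "w i \<noteq> 0"
    using weight_sum by (metis sum.neutral zero_neq_one)
  then have "0 < w i * lik N0 (d i) z"
    using weight_nonneg[of i] by simp
  also have "\<dots> \<le> mix z"
    by (rule weight_le_mix) fact
  finally show ?thesis .
qed

lemma mix_minus_1: "mix z - 1 = (\<Sum>i\<in>I. w i * (lik N0 (d i) z - 1))"
  using weight_sum by (simp add: mix_def right_diff_distrib sum_subtractf)

lemma abs_average_le:
  assumes "\<And>i. i \<in> I \<Longrightarrow> \<bar>f i\<bar> \<le> B"
  shows "\<bar>\<Sum>i\<in>I. w i * f i\<bar> \<le> (B :: real)"
proof -
  have "\<bar>\<Sum>i\<in>I. w i * f i\<bar> \<le> (\<Sum>i\<in>I. w i * B)"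
    using assms weight_nonneg by (intro order_trans[OF sum_abs] sum_mono) (auto simp: abs_mult mult_left_mono)
  also have "\<dots> = B"
    by (simp add: weight_sum flip: sum_distrib_right)
  finally show ?thesis .
qed

text \<open>Jensen's inequality for the fourth power. The fourth moment enters only the remainder,
  so an upper bound replaces its exact fourfold sum.\<close>

lemma average_power4_le: "(\<Sum>i\<in>I. w i * f i) ^ 4 \<le> (\<Sum>i\<in>I. w i * f i ^ 4 :: real)"
proof -
  have "I \<noteq> {}"
    using weight_sum by auto
  then show ?thesis
    using convex_on_sum[OF finite _ convex_power_even[of 4] weight_sum, of f] weight_nonneg by simp
qed

lemma has_bochner_integral_mix_minus_1: "has_bochner_integral (noise N0) (\<lambda>z. mix z - 1) 0"
proof -
  have "has_bochner_integral (noise N0) (\<lambda>z. \<Sum>i\<in>I. w i * (lik N0 (d i) z - 1)) (\<Sum>i\<in>I. w i * 0)"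
    by (intro has_bochner_integral_sum has_bochner_integral_mult_right
        has_bochner_integral_lik_minus_1 N0)
  then show ?thesis
    by (simp add: mix_minus_1)
qed

lemma has_bochner_integral_mix: "has_bochner_integral (noise N0) mix 1"
  using has_bochner_integral_add[OF has_bochner_integral_mix_minus_1 has_bochner_integral_one_noise[OF N0]]
  by simp

lemma has_bochner_integral_mix_2:
  "has_bochner_integral (noise N0) (\<lambda>z. (mix z - 1)\<^sup>2)
    (\<Sum>i\<in>I. w i * (\<Sum>j\<in>I. w j * (exp (2 * (d i \<bullet> d j) / N0) - 1)))"
proof -
  have "(mix z - 1)\<^sup>2 =
      (\<Sum>i\<in>I. w i * (\<Sum>j\<in>I. w j * ((lik N0 (d i) z - 1) * (lik N0 (d j) z - 1))))" for z
    unfolding mix_minus_1 power2_eq_square sum_product sum_distrib_left sum_distrib_right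
    by (intro sum.cong) (simp_all only: mult_ac)
  then show ?thesis
    by (simp only:) (intro has_bochner_integral_sum has_bochner_integral_mult_right
        has_bochner_integral_lik_2 N0)
qed

lemma has_bochner_integral_mix_3:
  "has_bochner_integral (noise N0) (\<lambda>z. (mix z - 1) ^ 3)
    (\<Sum>i\<in>I. w i * (\<Sum>j\<in>I. w j * (\<Sum>k\<in>I. w k *
      (exp (2 * (d i \<bullet> d j + d i \<bullet> d k + d j \<bullet> d k) / N0) - exp (2 * (d i \<bullet> d j) / N0)
        - exp (2 * (d i \<bullet> d k) / N0) - exp (2 * (d j \<bullet> d k) / N0) + 2))))"
proof -
  have "(mix z - 1) ^ 3 = (\<Sum>i\<in>I. w i * (\<Sum>j\<in>I. w j * (\<Sum>k\<in>I. w k *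
      ((lik N0 (d i) z - 1) * (lik N0 (d j) z - 1) * (lik N0 (d k) z - 1)))))" for z
    unfolding mix_minus_1 power3_eq_cube sum_product sum_distrib_left sum_distrib_right
    by (intro sum.cong) (simp_all only: mult_ac)
  then show ?thesis
    by (simp only:) (intro has_bochner_integral_sum has_bochner_integral_mult_right
        has_bochner_integral_lik_3 N0)
qed

lemma
  shows integrable_mix_4: "integrable (noise N0) (\<lambda>z. (mix z - 1) ^ 4)"
    and integral_mix_4_le: "(\<integral>z. (mix z - 1) ^ 4 \<partial>noise N0) \<le> (\<Sum>i\<in>I. w i *
      (exp (12 * (d i \<bullet> d i) / N0) - 4 * exp (6 * (d i \<bullet> d i) / N0) + 6 * exp (2 * (d i \<bullet> d i) / N0) - 3))"
proof -
  have bound: "has_bochner_integral (noise N0) (\<lambda>z. \<Sum>i\<in>I. w i * (lik N0 (d i) z - 1) ^ 4)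
    (\<Sum>i\<in>I. w i * (exp (12 * (d i \<bullet> d i) / N0) - 4 * exp (6 * (d i \<bullet> d i) / N0)
      + 6 * exp (2 * (d i \<bullet> d i) / N0) - 3))"
    by (intro has_bochner_integral_sum has_bochner_integral_mult_right has_bochner_integral_lik_4 N0)
  have le: "(mix z - 1) ^ 4 \<le> (\<Sum>i\<in>I. w i * (lik N0 (d i) z - 1) ^ 4)" for z
    unfolding mix_minus_1 by (rule average_power4_le)
  show int: "integrable (noise N0) (\<lambda>z. (mix z - 1) ^ 4)"
    by (rule Bochner_Integration.integrable_bound[OF integrable.intros[OF bound]])
      (auto intro!: order_trans[OF le])
  show "(\<integral>z. (mix z - 1) ^ 4 \<partial>noise N0) \<le> (\<Sum>i\<in>I. w i *
      (exp (12 * (d i \<bullet> d i) / N0) - 4 * exp (6 * (d i \<bullet> d i) / N0) + 6 * exp (2 * (d i \<bullet> d i) / N0) - 3))"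
    unfolding has_bochner_integral_integral_eq[OF bound, symmetric]
    by (intro integral_mono int integrable.intros[OF bound] le)
qed

lemma integrable_mix_ln_mix: "integrable (noise N0) (\<lambda>z. mix z * ln (mix z))"
proof (rule Bochner_Integration.integrable_bound)
  show "integrable (noise N0) (\<lambda>z. (mix z - 1)\<^sup>2 + \<bar>mix z - 1\<bar>)"
    using has_bochner_integral_mix_minus_1 has_bochner_integral_mix_2
    by (intro Bochner_Integration.integrable_add integrable_abs) (rule integrable.intros, assumption)+
  have "\<bar>mix z * ln (mix z)\<bar> \<le> (mix z - 1)\<^sup>2 + \<bar>mix z - 1\<bar>" for z
  proof -
    have "(mix z)\<^sup>2 - mix z = (mix z - 1)\<^sup>2 + (mix z - 1)"
      by (simp add: power2_eq_square algebra_simps)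
    then show ?thesis
      using x_ln_x_bounds[OF mix_pos[of z]] zero_le_power2[of "mix z - 1"] by linarith
  qed
  then show "AE z in noise N0. norm (mix z * ln (mix z)) \<le> norm ((mix z - 1)\<^sup>2 + \<bar>mix z - 1\<bar>)"
    by simp
qed measurable

text \<open>
  The cubic term matters: the third central moment of the likelihood ratio is of order \<open>r ^ 4\<close>
  rather than \<open>r ^ 3\<close>, because its exponents cancel to first order.
\<close>

lemma integral_mix_ln_mix:
  assumes r: "\<And>i. i \<in> I \<Longrightarrow> norm (d i) \<le> r" and small: "12 * r\<^sup>2 \<le> N0"
  shows "\<bar>(\<integral>z. mix z * ln (mix z) \<partial>noise N0) - (norm (\<Sum>i\<in>I. w i *\<^sub>R d i))\<^sup>2 / N0\<bar>
    \<le> 114 * (r\<^sup>2 / N0)\<^sup>2"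
proof -
  define t where "t i j = 2 * (d i \<bullet> d j) / N0" for i j
  \<comment> \<open>\<open>s\<close> bounds every exponent \<open>t i j\<close>. The largest
    multiple that occurs is 6, so \<open>12 * r\<^sup>2 \<le> N0\<close> keeps all exponents within
    the range of \<open>exp_Taylor_1\<close>.\<close>
  define s where "s = 2 * r\<^sup>2 / N0"
  define e where "e u = exp u - 1 - u" for u :: real
  have s: "6 * s \<le> 1" "0 \<le> s"
    using small N0 by (simp_all add: s_def field_simps)
  have t: "\<bar>t i j\<bar> \<le> s" if "i \<in> I" "j \<in> I" for i j
  proof -
    have "\<bar>d i \<bullet> d j\<bar> \<le> norm (d i) * norm (d j)"
      by (rule Cauchy_Schwarz_ineq2)
    also have "\<dots> \<le> r * r"
      using that r norm_ge_zero[of "d i"] by (intro mult_mono) (auto intro: order_trans[OF norm_ge_zero])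
    finally show ?thesis
      using N0 by (simp add: t_def s_def abs_mult power2_eq_square divide_right_mono)
  qed
  have e: "\<bar>e u\<bar> \<le> (c * s)\<^sup>2" if "\<bar>u\<bar> \<le> c * s" "c \<le> 6" for u c
  proof -
    have "c * s \<le> 6 * s"
      using that s by (intro mult_right_mono) auto
    then have "\<bar>e u\<bar> \<le> \<bar>u\<bar>\<^sup>2"
      using exp_Taylor_1[of u] that s by (simp add: e_def)
    also have "\<dots> \<le> (c * s)\<^sup>2"
      using that by (intro power_mono) auto
    finally show ?thesis .
  qed
  let ?G2 = "\<integral>z. (mix z - 1)\<^sup>2 \<partial>noise N0" and ?G3 = "\<integral>z. (mix z - 1) ^ 3 \<partial>noise N0"
    and ?G4 = "\<integral>z. (mix z - 1) ^ 4 \<partial>noise N0"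
  have "\<bar>\<Sum>i\<in>I. w i * (\<Sum>j\<in>I. w j * e (t i j))\<bar> \<le> s\<^sup>2"
    using e[of _ 1] t by (intro abs_average_le) auto
  also have "(\<Sum>i\<in>I. w i * (\<Sum>j\<in>I. w j * e (t i j))) =
      ?G2 - (\<Sum>i\<in>I. w i * (\<Sum>j\<in>I. w j * t i j))"
    unfolding has_bochner_integral_integral_eq[OF has_bochner_integral_mix_2]
    by (simp add: e_def t_def right_diff_distrib sum_subtractf)
  also have "(\<Sum>i\<in>I. w i * (\<Sum>j\<in>I. w j * t i j)) = 2 * ((norm (\<Sum>i\<in>I. w i *\<^sub>R d i))\<^sup>2 / N0)"
    unfolding power2_norm_eq_inner inner_sum_left inner_sum_right sum_distrib_left sum_divide_distrib
    by (intro sum.cong) (auto simp: t_def inner_commute mult_ac)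
  finally have G2: "\<bar>?G2 / 2 - (norm (\<Sum>i\<in>I. w i *\<^sub>R d i))\<^sup>2 / N0\<bar> \<le> s\<^sup>2 / 2"
    by linarith
  \<comment> \<open>Constant and linear parts cancel, leaving only the errors \<open>e\<close>: 9
    for the threefold sum of exponents and 1 for each of the three single ones.\<close>
  have "\<bar>?G3\<bar> \<le> 12 * s\<^sup>2"
    unfolding has_bochner_integral_integral_eq[OF has_bochner_integral_mix_3]
  proof (intro abs_average_le)
    fix i j k
    assume ijk: "i \<in> I" "j \<in> I" "k \<in> I"
    have "2 * (d i \<bullet> d j + d i \<bullet> d k + d j \<bullet> d k) / N0 = t i j + t i k + t j k"
      by (simp add: t_def add_divide_distrib)
    then have "exp (2 * (d i \<bullet> d j + d i \<bullet> d k + d j \<bullet> d k) / N0) - exp (2 * (d i \<bullet> d j) / N0)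
        - exp (2 * (d i \<bullet> d k) / N0) - exp (2 * (d j \<bullet> d k) / N0) + 2 =
        e (t i j + t i k + t j k) - e (t i j) - e (t i k) - e (t j k)"
      by (simp add: e_def t_def)
    moreover have "\<bar>e (t i j + t i k + t j k)\<bar> \<le> 9 * s\<^sup>2"
      using t[OF ijk(1,2)] t[OF ijk(1,3)] t[OF ijk(2,3)] e[of _ 3] by simp
    moreover have "\<bar>e (t i j)\<bar> \<le> s\<^sup>2" "\<bar>e (t i k)\<bar> \<le> s\<^sup>2" "\<bar>e (t j k)\<bar> \<le> s\<^sup>2"
      using t[OF ijk(1,2)] t[OF ijk(1,3)] t[OF ijk(2,3)] e[of _ 1] by auto
    ultimately show "\<bar>exp (2 * (d i \<bullet> d j + d i \<bullet> d k + d j \<bullet> d k) / N0) - exp (2 * (d i \<bullet> d j) / N0)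
        - exp (2 * (d i \<bullet> d k) / N0) - exp (2 * (d j \<bullet> d k) / N0) + 2\<bar> \<le> 12 * s\<^sup>2"
      by linarith
  qed
  \<comment> \<open>Again only the errors \<open>e\<close> survive:
    \<open>36 + 4 * 9 + 6 = 78\<close>.\<close>
  moreover have "?G4 \<le> 78 * s\<^sup>2"
  proof (rule order_trans[OF integral_mix_4_le], rule order_trans[OF abs_ge_self], rule abs_average_le)
    fix i
    assume i: "i \<in> I"
    have "12 * (d i \<bullet> d i) / N0 = 6 * t i i" "6 * (d i \<bullet> d i) / N0 = 3 * t i i"
      by (simp_all add: t_def)
    then have "exp (12 * (d i \<bullet> d i) / N0) - 4 * exp (6 * (d i \<bullet> d i) / N0) + 6 * exp (2 * (d i \<bullet> d i) / N0) - 3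
        = e (6 * t i i) - 4 * e (3 * t i i) + 6 * e (t i i)"
      by (simp add: e_def t_def)
    moreover have "\<bar>e (6 * t i i)\<bar> \<le> 36 * s\<^sup>2" "\<bar>e (3 * t i i)\<bar> \<le> 9 * s\<^sup>2" "\<bar>e (t i i)\<bar> \<le> s\<^sup>2"
      using t[OF i i] e[of "6 * t i i" 6] e[of "3 * t i i" 3] e[of "t i i" 1] by auto
    ultimately show "\<bar>exp (12 * (d i \<bullet> d i) / N0) - 4 * exp (6 * (d i \<bullet> d i) / N0)
        + 6 * exp (2 * (d i \<bullet> d i) / N0) - 3\<bar> \<le> 78 * s\<^sup>2"
      by linarith
  qed
  moreover have "\<bar>(\<integral>z. mix z * ln (mix z) \<partial>noise N0) - (?G2 / 2 - ?G3 / 6)\<bar> \<le> ?G4 / 3"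
  proof -
    note I1 = integrable.intros[OF has_bochner_integral_mix_minus_1]
      and I2 = integrable.intros[OF has_bochner_integral_mix_2]
      and I3 = integrable.intros[OF has_bochner_integral_mix_3]
    let ?p = "\<lambda>z. (mix z - 1) + (mix z - 1)\<^sup>2 / 2 - (mix z - 1) ^ 3 / 6"
    have p: "integrable (noise N0) ?p"
      using I1 I2 I3 by simp
    have "(\<integral>z. ?p z \<partial>noise N0) = ?G2 / 2 - ?G3 / 6"
      using I1 I2 I3 has_bochner_integral_integral_eq[OF has_bochner_integral_mix_minus_1] by simp
    then have eq: "(\<integral>z. mix z * ln (mix z) \<partial>noise N0) - (?G2 / 2 - ?G3 / 6) =
        (\<integral>z. mix z * ln (mix z) - ?p z \<partial>noise N0)"
      using p integrable_mix_ln_mix by (simp only: Bochner_Integration.integral_diff)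
    have "0 \<le> (\<integral>z. mix z * ln (mix z) - ?p z \<partial>noise N0)"
      by (intro Bochner_Integration.integral_nonneg x_ln_x_Taylor mix_pos)
    moreover have "(\<integral>z. mix z * ln (mix z) - ?p z \<partial>noise N0) \<le> (\<integral>z. (mix z - 1) ^ 4 / 3 \<partial>noise N0)"
      using p integrable_mix_ln_mix integrable_mix_4
      by (intro integral_mono x_ln_x_Taylor mix_pos) auto
    ultimately show ?thesis
      unfolding eq by simp
  qed
  \<comment> \<open>The total is \<open>1 / 2 + 12 / 6 + 78 / 3 = 57 / 2\<close>; the factor 4 in
    the square of \<open>s\<close> makes it 114.\<close>
  ultimately have "\<bar>(\<integral>z. mix z * ln (mix z) \<partial>noise N0) - (norm (\<Sum>i\<in>I. w i *\<^sub>R d i))\<^sup>2 / N0\<bar>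
      \<le> 57 * s\<^sup>2 / 2"
    using G2 by linarith
  then show ?thesis
    by (simp add: s_def power_divide power_mult_distrib)
qed

end

section \<open>Low-SNR expansion of the BICM capacity\<close>

lemma symbol_nth:
  assumes "labeling m L" "i < 2 ^ m"
  shows "symbol x L (L ! i) = x i"
proof -
  have "(THE j. j < length L \<and> L ! j = L ! i) = i"
    using assms labeling_length[OF assms(1)]
    by (intro the_equality) (auto simp: labeling_def nth_eq_iff_index_eq)
  then show ?thesis
    by (simp add: symbol_def)
qed

lemma sum_labeling:
  assumes "labeling m L"
  shows "(\<Sum>c | length c = m. f c) = (\<Sum>i<2 ^ m. f (L ! i))"
  using assms labeling_length[OF assms] bij_betw_nth[of L "{..<2 ^ m}" "{c. length c = m}"]
  by (intro sum.reindex_bij_betw[symmetric]) (simp add: labeling_def)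

lemma pmf_bits: "pmf (bits m) c = (if length c = m then 1 / 2 ^ m else 0)"
proof -
  have fin: "finite {c :: bool list. length c = m}" "{c :: bool list. length c = m} \<noteq> {}" for m
    using finite_lists_length_eq[of "UNIV :: bool set" m] Ex_list_of_length[of m] by auto
  have "bits m = pmf_of_set {c. length c = m}"
  proof (induction m)
    case 0
    have "{c :: bool list. length c = 0} = {[]}"
      by auto
    then show ?case
      by (simp add: bits_def pmf_of_set_singleton)
  next
    case (Suc m)
    let ?A = "{c :: bool list. length c = m}"
    have "bits (Suc m) = map_pmf (\<lambda>(b, c). b # c) (pair_pmf (pmf_of_set UNIV) (pmf_of_set ?A))"
      using Suc by (simp add: bits_def pair_pmf_def map_bind_pmf map_pmf_def[symmetric] bernoulli_pmf_half_conv_pmf_of_set 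
          map_return_pmf map_pmf_comp bind_return_pmf bind_assoc_pmf)
    also have "pair_pmf (pmf_of_set (UNIV :: bool set)) (pmf_of_set ?A) = pmf_of_set (UNIV \<times> ?A)"
    proof (rule pmf_eqI)
      fix p :: "bool \<times> bool list"
      show "pmf (pair_pmf (pmf_of_set UNIV) (pmf_of_set ?A)) p = pmf (pmf_of_set (UNIV \<times> ?A)) p"
        using fin by (cases p) (simp add: pmf_pair indicator_def card_cartesian_product)
    qed
    also have "map_pmf (\<lambda>(b, c). b # c) (pmf_of_set (UNIV \<times> ?A)) =
        pmf_of_set ((\<lambda>(b, c). b # c) ` (UNIV \<times> ?A))"
      using fin by (intro map_pmf_of_set_inj) (auto simp: inj_on_def)
    also have "(\<lambda>(b, c). b # c) ` (UNIV \<times> ?A) = {c. length c = Suc m}"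
      by (auto simp: length_Suc_conv)
    finally show ?case .
  qed
  then show ?thesis
    using card_lists_length_eq[of "UNIV :: bool set" m] fin[of m]
    by (simp add: pmf_of_set[OF fin(2) fin(1)] indicator_def)
qed

lemma expectation_bits:
  assumes "labeling m L"
  shows "measure_pmf.expectation (bits m) f = (\<Sum>i<2 ^ m. f (L ! i) / 2 ^ m :: real)"
proof -
  have "measure_pmf.expectation (bits m) f = (\<Sum>c | length c = m. f c * pmf (bits m) c)"
    using finite_set_pmf_bits[of m] by (intro integral_measure_pmf_real) (auto simp: set_pmf_bits)
  also have "\<dots> = (\<Sum>i<2 ^ m. f (L ! i) * pmf (bits m) (L ! i))"
    by (rule sum_labeling[OF assms])
  also have "\<dots> = (\<Sum>i<2 ^ m. f (L ! i) / 2 ^ m)"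
    using assms labeling_length[OF assms] nth_mem[of _ L]
    by (intro sum.cong) (auto simp: pmf_bits labeling_def)
  finally show ?thesis .
qed

text \<open>Flipping bit \<open>k\<close> maps the two events onto each other bijectively.\<close>

lemma prob_bit:
  assumes "k < m"
  shows "measure_pmf.prob (bits m) {c. c ! k = b} = 1 / 2"
proof -
  let ?P = "\<lambda>b. measure_pmf.prob (bits m) {c. c ! k = b}"
  have eq: "?P b = (\<Sum>c | length c = m \<and> c ! k = b. 1 / 2 ^ m)" for b
  proof -
    have "?P b = measure_pmf.prob (bits m) {c. length c = m \<and> c ! k = b}"
      by (rule measure_prob_cong_0) (auto simp: pmf_bits)
    also have "\<dots> = (\<Sum>c | length c = m \<and> c ! k = b. pmf (bits m) c)"
      using finite_set_pmf_bits[of m]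
      by (intro measure_measure_pmf_finite) (auto simp: set_pmf_bits elim: rev_finite_subset)
    finally show ?thesis
      by (simp add: pmf_bits)
  qed
  have "?P b = ?P (\<not> b)" for b
    unfolding eq using assms
    by (intro sum.reindex_bij_witness[of _ "\<lambda>c. c[k := b]" "\<lambda>c. c[k := \<not> b]"])
      (auto simp: list_update_same_conv)
  moreover have "?P b + ?P (\<not> b) = 1"
  proof -
    have "- {c. c ! k = b} = {c. c ! k = (\<not> b)}"
      by auto
    then show ?thesis
      using measure_pmf.prob_compl[of "{c. c ! k = b}" "bits m"] by (simp add: Compl_eq_Diff_UNIV)
  qed
  ultimately show ?thesis
    by simp
qed

definition bit_weight :: "nat \<Rightarrow> bool list list \<Rightarrow> nat \<Rightarrow> bool \<Rightarrow> nat \<Rightarrow> real" where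
  "bit_weight m L k b i = (if L ! i ! k = b then 2 / 2 ^ m else 0)"

lemma expectation_bit_law:
  assumes L: "labeling m L" and k: "k < m"
  shows "measure_pmf.expectation (bit_law m k b) f = (\<Sum>i<2 ^ m. bit_weight m L k b i * f (L ! i))"
proof -
  note ne = set_pmf_bits_bit[OF k, of b]
  have "measure_pmf.expectation (bit_law m k b) f = (\<Sum>c | length c = m. f c * pmf (bit_law m k b) c)"
    using finite_set_pmf_bits[of m]
    by (intro integral_measure_pmf_real) (auto simp: bit_law_def set_cond_pmf[OF ne] set_pmf_bits)
  also have "\<dots> = (\<Sum>i<2 ^ m. f (L ! i) * pmf (bit_law m k b) (L ! i))"
    by (rule sum_labeling[OF L])
  also have "\<dots> = (\<Sum>i<2 ^ m. bit_weight m L k b i * f (L ! i))"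
    using L labeling_length[OF L] nth_mem[of _ L]
    by (intro sum.cong)
      (auto simp: bit_law_def pmf_cond[OF ne] pmf_bits prob_bit[OF k] labeling_def bit_weight_def)
  finally show ?thesis .
qed

lemma sum_bit_weight:
  assumes "labeling m L" "k < m"
  shows "(\<Sum>i<2 ^ m. bit_weight m L k b i) = 1"
  using expectation_bit_law[OF assms, of b "\<lambda>_. 1"] by simp

lemma bit_weight_sign:
  "bsign (L ! i ! k) / 2 ^ m = 1 / 2 * (bit_weight m L k False i - bit_weight m L k True i)"
  by (simp add: bit_weight_def)

lemma times_vec_scaleR: "h * ((s *\<^sub>R x) /\<^sub>R 2 ^ m) = (s / 2 ^ m) *\<^sub>R (h * x :: real ^ 'n)"
  by (simp add: vec_eq_iff divide_inverse)

text \<open>The variance of a fair two-point variable in \<open>a\<close> and \<open>b\<close>. It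
  turns the mean of the two conditional energies minus the overall one into the squared norm of a
  column sum.\<close>

lemma parallelogram_halves:
  fixes a b :: "'a :: real_inner"
  shows "((norm a)\<^sup>2 + (norm b)\<^sup>2) / 2 - (norm ((1 / 2) *\<^sub>R (a + b)))\<^sup>2 = (norm ((1 / 2) *\<^sub>R (b - a)))\<^sup>2"
  unfolding power2_norm_eq_inner by (simp add: inner_simps inner_commute field_simps)

lemma norm_times_vec_le: "norm (h * v :: real ^ 'n) \<le> norm h * norm v"
proof -
  have "norm (h * v) \<le> norm (norm v *\<^sub>R h)"
    by (rule norm_le_componentwise_cart)
      (simp add: abs_mult mult.commute[of "norm v"] mult_left_mono component_le_norm_cart)
  then show ?thesis
    by (simp add: mult.commute)
qed

text \<open>
  The conditional mutual information, given fading \<open>h\<close>, between bit \<open>k\<close> and the output.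
\<close>

definition cond_info :: "nat \<Rightarrow> (nat \<Rightarrow> real ^ 'n) \<Rightarrow> bool list list \<Rightarrow> real \<Rightarrow> nat \<Rightarrow> real ^ 'n \<Rightarrow> real" where
  "cond_info m x L N0 k h = (\<Sum>i<2 ^ m. (\<integral>z. information_density m x L N0 k (L ! i ! k) h (h * x i + z)
     \<partial>noise N0) / 2 ^ m)"

text \<open>Fubini, with the bits outermost as a finite average over rows, then the fading, then the
  noise.\<close>

lemma integral_information_density:
  fixes PH :: "(real ^ 'n) measure"
  assumes PH: "prob_space PH" "sets PH = sets borel" and N0: "N0 > 0" and k: "k < m"
    and L: "labeling m L"
  shows integrable_cond_info: "integrable PH (cond_info m x L N0 k)"
    and "(\<integral>(c, h, z). information_density m x L N0 k (c ! k) h (channel_output x L c h z)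
      \<partial>channel_space m PH N0) = (\<integral>h. cond_info m x L N0 k h \<partial>PH)"
proof -
  interpret PH: prob_space PH by fact
  interpret noise: prob_space "noise N0 :: (real ^ 'n) measure" using N0 by (rule prob_space_noise)
  interpret HZ: pair_sigma_finite PH "noise N0 :: (real ^ 'n) measure" ..
  interpret HZP: prob_space "PH \<Otimes>\<^sub>M (noise N0 :: (real ^ 'n) measure)"
    by (intro prob_space_pair PH noise.prob_space_axioms)
  interpret C: pair_sigma_finite "measure_pmf (bits m)" "PH \<Otimes>\<^sub>M (noise N0 :: (real ^ 'n) measure)" ..
  let ?f = "\<lambda>c (h, z). information_density m x L N0 k (c ! k) h (channel_output x L c h z)"
  have int: "integrable (measure_pmf (bits m) \<Otimes>\<^sub>M (PH \<Otimes>\<^sub>M noise N0)) (\<lambda>(c, w). ?f c w)"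
    using integrable_information_density[OF PH N0 k, of x L]
    by (simp add: channel_space_def case_prod_unfold)
  have int_c: "integrable (PH \<Otimes>\<^sub>M noise N0) (?f c)" if "length c = m" for c
    using C.AE_integrable_fst'[OF int] that by (auto simp: AE_measure_pmf_iff set_pmf_bits)
  have len: "length (L ! i) = m" if "i < 2 ^ m" for i
    using L labeling_length[OF L] nth_mem[of i L] that by (auto simp: labeling_def)
  have info: "cond_info m x L N0 k = (\<lambda>h. \<Sum>i<2 ^ m. (\<integral>z. ?f (L ! i) (h, z) \<partial>noise N0) / 2 ^ m)"
    using L by (simp add: cond_info_def[abs_def] channel_output_def symbol_nth)
  have int_i: "integrable PH (\<lambda>h. (\<integral>z. ?f (L ! i) (h, z) \<partial>noise N0) / 2 ^ m)" if "i < 2 ^ m" for i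
    using HZ.integrable_fst'[OF int_c[OF len[OF that]]] by (intro integrable_divide) simp
  show "integrable PH (cond_info m x L N0 k)"
    unfolding info using int_i by (intro Bochner_Integration.integrable_sum) simp
  have "(\<integral>(c, h, z). information_density m x L N0 k (c ! k) h (channel_output x L c h z)
      \<partial>channel_space m PH N0) = (\<integral>c. (\<integral>w. ?f c w \<partial>(PH \<Otimes>\<^sub>M noise N0)) \<partial>measure_pmf (bits m))"
    using C.integral_fst'[OF int] by (simp add: channel_space_def case_prod_unfold)
  also have "\<dots> = (\<Sum>i<2 ^ m. (\<integral>w. ?f (L ! i) w \<partial>(PH \<Otimes>\<^sub>M noise N0)) / 2 ^ m)"
    by (rule expectation_bits[OF L])
  also have "\<dots> = (\<Sum>i<2 ^ m. \<integral>h. (\<integral>z. ?f (L ! i) (h, z) \<partial>noise N0) / 2 ^ m \<partial>PH)"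
    using HZ.integral_fst'[OF int_c[OF len]] by (intro sum.cong) simp_all
  also have "\<dots> = (\<integral>h. cond_info m x L N0 k h \<partial>PH)"
    unfolding info using int_i by (intro Bochner_Integration.integral_sum[symmetric]) simp
  finally show "(\<integral>(c, h, z). information_density m x L N0 k (c ! k) h (channel_output x L c h z)
      \<partial>channel_space m PH N0) = (\<integral>h. cond_info m x L N0 k h \<partial>PH)" .
qed

text \<open>The lower bound is the convexity of \<open>u * ln u\<close>. The upper bound uses that
  \<open>a\<close> and \<open>b\<close> are at most twice their mean, so their logarithms exceed
  that of the mean by at most 1. Integrated, they confine the information of one bit to at most 1
  nat.\<close>

lemma entropy_gap_bounds:
  fixes a b :: real
  assumes "a > 0" "b > 0"
  defines "l \<equiv> (a + b) / 2"
  shows "0 \<le> (a * ln a + b * ln b) / 2 - l * ln l" and "(a * ln a + b * ln b) / 2 - l * ln l \<le> l"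
proof -
  have lower: "u * ln l \<le> u * ln u + (l - u)" and upper: "u * ln u \<le> u * ln l + u"
    if "u > 0" "u \<le> 2 * l" for u
  proof -
    have l: "l > 0"
      using assms by (simp add: l_def)
    have "ln (l / u) \<le> l / u - 1"
      using that l by (intro ln_le_minus_one) simp
    then have "u * ln (l / u) \<le> u * (l / u - 1)"
      using that by (intro mult_left_mono) auto
    then show "u * ln l \<le> u * ln u + (l - u)"
      using that l by (simp add: ln_div algebra_simps)
    have "ln (u / l) \<le> u / l - 1"
      using that l by (intro ln_le_minus_one) simp
    also have "\<dots> \<le> 1"
      using that l by (simp add: field_simps)
    finally have "u * ln (u / l) \<le> u * 1"
      using that by (intro mult_left_mono) auto
    then show "u * ln u \<le> u * ln l + u"
      using that l by (simp add: ln_div algebra_simps)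
  qed
  have ll: "l * ln l = (a * ln l + b * ln l) / 2"
    by (simp add: l_def field_simps)
  have ab: "a \<le> 2 * l" "b \<le> 2 * l" "a + b = 2 * l"
    using assms by (auto simp: l_def)
  show "0 \<le> (a * ln a + b * ln b) / 2 - l * ln l"
    using add_mono[OF lower[OF assms(1) ab(1)] lower[OF assms(2) ab(2)]] ab(3)
    by (simp add: ll)
  show "(a * ln a + b * ln b) / 2 - l * ln l \<le> l"
    using add_mono[OF upper[OF assms(1) ab(1)] upper[OF assms(2) ab(2)]] ab(3)
    by (simp add: ll field_simps)
qed

lemma average_error:
  fixes a b c :: real
  assumes "\<bar>a - a'\<bar> \<le> e" "\<bar>b - b'\<bar> \<le> e" "\<bar>c - c'\<bar> \<le> e"
  shows "\<bar>(a + b) / 2 - c - ((a' + b') / 2 - c')\<bar> \<le> 2 * e"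
  using assms unfolding abs_le_iff by (simp add: field_simps)

text \<open>The bound must hold for all \<open>h\<close>, since the fading is unbounded. If
  \<open>norm h\<close> is small relative to \<open>N0\<close>, the expansion of the three mixtures
  applies; otherwise both the information and its approximation are already dominated by the error
  term.\<close>

lemma cond_info_approx:
  fixes x :: "nat \<Rightarrow> real ^ 'n" and h :: "real ^ 'n"
  assumes N0: "N0 > 0" and k: "k < m" and L: "labeling m L"
    and R: "\<And>i. i < 2 ^ m \<Longrightarrow> norm (x i) \<le> R"
  shows "\<bar>cond_info m x L N0 k h * ln 2 - (norm (h * (column_sum m x L k /\<^sub>R 2 ^ m)))\<^sup>2 / N0\<bar>
    \<le> 228 * ((norm h * R)\<^sup>2 / N0)\<^sup>2"
proof -
  let ?I = "{..<2 ^ m} :: nat set" and ?d = "\<lambda>i. h * x i"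
  interpret U: shift_mixture N0 ?I "\<lambda>_. 1 / 2 ^ m" ?d
    by unfold_locales (auto simp: N0)
  interpret B: shift_mixture N0 ?I "bit_weight m L k b" ?d for b
    by unfold_locales (auto simp: N0 sum_bit_weight[OF L k], simp add: bit_weight_def)
  have U: "output_pdf (bits m) x L N0 h z = noise_pdf N0 z * U.mix z" for z
    using L by (simp add: output_pdf_def expectation_bits symbol_nth noise_pdf_shift[OF N0]
        U.mix_def sum_distrib_left)
  have B: "output_pdf (bit_law m k b) x L N0 h z = noise_pdf N0 z * B.mix b z" for b z
    using L k by (simp add: output_pdf_def expectation_bit_law symbol_nth noise_pdf_shift[OF N0]
        B.mix_def sum_distrib_left mult_ac)
  have info: "information_density m x L N0 k b h z * ln 2 = ln (B.mix b z) - ln (U.mix z)" for b z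
    using noise_pdf_pos[OF N0, of z] U.mix_pos[of z] B.mix_pos[of b z]
    by (simp add: information_density_def U B log_def ln_div)
  have avg: "U.mix z = (B.mix True z + B.mix False z) / 2" for z
    unfolding U.mix_def B.mix_def sum.distrib[symmetric] sum_divide_distrib
    by (intro sum.cong) (simp_all add: bit_weight_def)
  have [measurable]: "information_density m x L N0 k b h \<in> borel_measurable borel" for b
  proof -
    have "information_density m x L N0 k b h = (\<lambda>z. (ln (B.mix b z) - ln (U.mix z)) / ln 2)"
      by (simp add: fun_eq_iff info[symmetric])
    then show ?thesis
      by simp
  qed
  let ?g = "\<lambda>b z. ln (B.mix b z) - ln (U.mix z)"
  \<comment> \<open>Exchanging sum and integral needs each row separately. The weighted ratio of row
    \<open>i\<close> is below both mixtures containing it, so the two integrable entropy terms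
    dominate.\<close>
  have int_i: "integrable (noise N0) (\<lambda>z. ?g (L ! i ! k) z * lik N0 (?d i) z / 2 ^ m)" if i: "i < 2 ^ m" for i
  proof (rule Bochner_Integration.integrable_bound)
    let ?b = "L ! i ! k"
    show "integrable (noise N0) (\<lambda>z. \<bar>B.mix ?b z * ln (B.mix ?b z)\<bar> + \<bar>U.mix z * ln (U.mix z)\<bar>)"
      using B.integrable_mix_ln_mix U.integrable_mix_ln_mix by simp
    have "\<bar>?g ?b z * lik N0 (?d i) z / 2 ^ m\<bar> \<le> \<bar>B.mix ?b z * ln (B.mix ?b z)\<bar> + \<bar>U.mix z * ln (U.mix z)\<bar>" for z
    proof -
      let ?l = "lik N0 (?d i) z / 2 ^ m"
      have "0 \<le> ?l"
        by (simp add: less_imp_le)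
      moreover have "?l \<le> U.mix z" "2 * ?l \<le> B.mix ?b z"
        using U.weight_le_mix[of i z] B.weight_le_mix[of i ?b z] i by (simp_all add: bit_weight_def)
      ultimately have l: "0 \<le> ?l" "?l \<le> U.mix z" "?l \<le> B.mix ?b z"
        by linarith+
      have "\<bar>?g ?b z * lik N0 (?d i) z / 2 ^ m\<bar> = \<bar>?g ?b z\<bar> * ?l"
        by (simp add: abs_mult abs_of_pos[OF lik_pos])
      also have "\<dots> \<le> (\<bar>ln (B.mix ?b z)\<bar> + \<bar>ln (U.mix z)\<bar>) * ?l"
        using l by (intro mult_right_mono) auto
      also have "\<dots> \<le> \<bar>ln (B.mix ?b z)\<bar> * B.mix ?b z + \<bar>ln (U.mix z)\<bar> * U.mix z"
        unfolding distrib_right using l by (intro add_mono mult_left_mono) auto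
      finally show ?thesis
        using B.mix_pos[of ?b z] U.mix_pos[of z] by (simp add: abs_mult mult.commute)
    qed
    then show "AE z in noise N0. norm (?g ?b z * lik N0 (?d i) z / 2 ^ m) \<le>
        norm (\<bar>B.mix ?b z * ln (B.mix ?b z)\<bar> + \<bar>U.mix z * ln (U.mix z)\<bar>)"
      by simp
  qed measurable
  let ?G = "\<lambda>z. (B.mix True z * ln (B.mix True z) + B.mix False z * ln (B.mix False z)) / 2
      - U.mix z * ln (U.mix z)"
  have "cond_info m x L N0 k h * ln 2 =
      (\<Sum>i<2 ^ m. (\<integral>z. information_density m x L N0 k (L ! i ! k) h z * lik N0 (?d i) z \<partial>noise N0) / 2 ^ m * ln 2)"
    by (simp add: cond_info_def integral_noise_shift[OF N0] sum_distrib_right)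
  also have "\<dots> = (\<Sum>i<2 ^ m. \<integral>z. ?g (L ! i ! k) z * lik N0 (?d i) z / 2 ^ m \<partial>noise N0)"
    by (simp add: info[symmetric] mult_ac)
  also have "\<dots> = (\<integral>z. (\<Sum>i<2 ^ m. ?g (L ! i ! k) z * lik N0 (?d i) z / 2 ^ m) \<partial>noise N0)"
    using int_i by (intro Bochner_Integration.integral_sum[symmetric]) simp
  \<comment> \<open>Rows are grouped by the value of bit \<open>k\<close>; each group carries half
    of the corresponding conditional mixture.\<close>
  also have "(\<lambda>z. \<Sum>i<2 ^ m. ?g (L ! i ! k) z * lik N0 (?d i) z / 2 ^ m) = ?G"
  proof
    fix z
    have "(\<Sum>i<2 ^ m. ?g (L ! i ! k) z * lik N0 (?d i) z / 2 ^ m) =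
        (?g True z * B.mix True z + ?g False z * B.mix False z) / 2"
      unfolding B.mix_def[of True] B.mix_def[of False] sum_distrib_left sum.distrib[symmetric] sum_divide_distrib
      by (intro sum.cong) (auto simp: bit_weight_def B.mix_def)
    also have "\<dots> = ?G z"
      unfolding avg by (simp add: field_simps)
    finally show "(\<Sum>i<2 ^ m. ?g (L ! i ! k) z * lik N0 (?d i) z / 2 ^ m) = ?G z" .
  qed
  finally have eq: "cond_info m x L N0 k h * ln 2 = integral\<^sup>L (noise N0) ?G" .
  have int_G: "integrable (noise N0) ?G"
    using B.integrable_mix_ln_mix U.integrable_mix_ln_mix by simp
  define T where "T = (norm (h * (column_sum m x L k /\<^sub>R 2 ^ m)))\<^sup>2"
  define q where "q = (norm h * R)\<^sup>2 / N0"
  have d: "norm (?d i) \<le> norm h * R" if "i \<in> ?I" for i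
    using R[of i] that by (intro order_trans[OF norm_times_vec_le] mult_left_mono) auto
  have "0 \<le> q"
    using N0 by (simp add: q_def)
  let ?\<mu> = "\<lambda>b. \<Sum>i<2 ^ m. bit_weight m L k b i *\<^sub>R ?d i"
  show ?thesis
  proof (cases "12 * (norm h * R)\<^sup>2 \<le> N0")
    case True
    have mean: "(\<Sum>i<2 ^ m. (1 / 2 ^ m) *\<^sub>R ?d i) = (1 / 2) *\<^sub>R (?\<mu> True + ?\<mu> False)"
    proof -
      have "(\<Sum>i<2 ^ m. (1 / 2 ^ m) *\<^sub>R ?d i) =
          (\<Sum>i<2 ^ m. (1 / 2) *\<^sub>R (bit_weight m L k True i *\<^sub>R ?d i + bit_weight m L k False i *\<^sub>R ?d i))"
      proof (rule sum.cong)
        fix i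
        show "(1 / 2 ^ m) *\<^sub>R ?d i =
            (1 / 2) *\<^sub>R (bit_weight m L k True i *\<^sub>R ?d i + bit_weight m L k False i *\<^sub>R ?d i)"
          by (cases "L ! i ! k") (simp_all add: bit_weight_def)
      qed simp
      then show ?thesis
        by (simp only: scaleR_sum_right[symmetric] sum.distrib)
    qed
    have diff: "h * (column_sum m x L k /\<^sub>R 2 ^ m) = (1 / 2) *\<^sub>R (?\<mu> False - ?\<mu> True)"
    proof -
      have "h * (column_sum m x L k /\<^sub>R 2 ^ m) =
          (\<Sum>i<2 ^ m. h * ((bsign (L ! i ! k) *\<^sub>R x i) /\<^sub>R 2 ^ m))"
        unfolding column_sum_def scaleR_sum_right sum_distrib_left ..
      also have "\<dots> =
          (\<Sum>i<2 ^ m. (1 / 2) *\<^sub>R (bit_weight m L k False i *\<^sub>R ?d i - bit_weight m L k True i *\<^sub>R ?d i))"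
      proof (rule sum.cong)
        fix i
        show "h * ((bsign (L ! i ! k) *\<^sub>R x i) /\<^sub>R 2 ^ m) =
            (1 / 2) *\<^sub>R (bit_weight m L k False i *\<^sub>R ?d i - bit_weight m L k True i *\<^sub>R ?d i)"
          unfolding times_vec_scaleR bit_weight_sign[of L i k m] by (simp only: scaleR_scaleR[symmetric] scaleR_diff_left)
      qed simp
      finally show ?thesis
        by (simp only: scaleR_sum_right[symmetric] sum_subtractf)
    qed
    have approx:
      "\<bar>(\<integral>z. B.mix b z * ln (B.mix b z) \<partial>noise N0) - (norm (?\<mu> b))\<^sup>2 / N0\<bar> \<le> 114 * q\<^sup>2"
      "\<bar>(\<integral>z. U.mix z * ln (U.mix z) \<partial>noise N0)
        - (norm (\<Sum>i<2 ^ m. (1 / 2 ^ m) *\<^sub>R ?d i))\<^sup>2 / N0\<bar> \<le> 114 * q\<^sup>2" for b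
      unfolding q_def using d True by (auto intro!: B.integral_mix_ln_mix U.integral_mix_ln_mix)
    have T: "((norm (?\<mu> True))\<^sup>2 + (norm (?\<mu> False))\<^sup>2) / 2 - (norm (\<Sum>i<2 ^ m. (1 / 2 ^ m) *\<^sub>R ?d i))\<^sup>2 = T"
      unfolding T_def diff mean by (rule parallelogram_halves)
    have TN: "T / N0 = ((norm (?\<mu> True))\<^sup>2 / N0 + (norm (?\<mu> False))\<^sup>2 / N0) / 2
        - (norm (\<Sum>i<2 ^ m. (1 / 2 ^ m) *\<^sub>R ?d i))\<^sup>2 / N0"
      unfolding T[symmetric] using N0 by (simp add: field_simps)
    have G: "integral\<^sup>L (noise N0) ?G =
        ((\<integral>z. B.mix True z * ln (B.mix True z) \<partial>noise N0) + (\<integral>z. B.mix False z * ln (B.mix False z) \<partial>noise N0)) / 2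
        - (\<integral>z. U.mix z * ln (U.mix z) \<partial>noise N0)"
      using B.integrable_mix_ln_mix U.integrable_mix_ln_mix by simp
    \<comment> \<open>The averaged conditional error and the unconditional error add up:
      \<open>2 * 114 = 228\<close>.\<close>
    show ?thesis
      unfolding eq T_def[symmetric] q_def[symmetric] G TN
      using average_error[OF approx(1)[of True] approx(1)[of False] approx(2)] by simp
  next
    case False
    have "0 \<le> integral\<^sup>L (noise N0) ?G"
      unfolding avg by (intro Bochner_Integration.integral_nonneg entropy_gap_bounds B.mix_pos)
    moreover have "integral\<^sup>L (noise N0) ?G \<le> integral\<^sup>L (noise N0) U.mix"
    proof (rule integral_mono[OF int_G integrable.intros[OF U.has_bochner_integral_mix]])
      show "?G z \<le> U.mix z" for z
        unfolding avg by (intro entropy_gap_bounds B.mix_pos)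
    qed
    moreover have "integral\<^sup>L (noise N0) U.mix = 1"
      by (rule has_bochner_integral_integral_eq[OF U.has_bochner_integral_mix])
    \<comment> \<open>As \<open>q\<close> exceeds \<open>1 / 12\<close>, both 1 and \<open>q\<close>
      are bounded by multiples of its square with factors below 228; these dominate the information
      and \<open>T / N0\<close>.\<close>
    moreover have "1 < 12 * q"
      using False N0 by (simp add: q_def field_simps)
    moreover from this have "q \<le> 12 * q\<^sup>2" "1 \<le> 144 * q\<^sup>2"
      using mult_mono[of 1 "12 * q" q q] mult_mono[of 1 "12 * q" 1 "12 * q"]
      by (simp_all add: power2_eq_square)
    moreover have "T / N0 \<le> q"
    proof -
      have "norm (column_sum m x L k) \<le> (\<Sum>i<(2 :: nat) ^ m. R)"
        unfolding column_sum_def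
        by (rule sum_norm_le) (use R in auto)
      then have "norm (column_sum m x L k /\<^sub>R 2 ^ m) \<le> R"
        by (simp add: divide_inverse[symmetric] field_simps)
      then have "norm (h * (column_sum m x L k /\<^sub>R 2 ^ m)) \<le> norm h * R"
        by (intro order_trans[OF norm_times_vec_le] mult_left_mono) auto
      then show ?thesis
        unfolding T_def q_def using N0 by (intro divide_right_mono power_mono) auto
    qed
    moreover have "0 \<le> T / N0"
      using N0 by (simp add: T_def)
    ultimately show ?thesis
      unfolding eq T_def[symmetric] q_def[symmetric] abs_le_iff by linarith
  qed
qed

text \<open>Slicing by the integer part of the squared norm bounds the fourth moment by a series of
  tail probabilities with quadratic weights; it converges because the tails decay faster than every
  power.\<close>

lemma integrable_norm_power4:
  assumes "fading_law PH PH1"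
  shows "integrable PH (\<lambda>h :: real ^ 'n. norm h ^ 4)"
proof -
  interpret prob_space PH
    using assms by (simp add: fading_law_def)
  have [measurable_cong]: "sets PH = sets borel"
    using assms by (simp add: fading_law_def)
  let ?A = "\<lambda>n::nat. {h :: real ^ 'n. (norm h)\<^sup>2 > real n}"
  obtain \<omega> where \<omega>: "\<omega> > 0"
    and tail: "\<forall>\<^sub>F \<Delta> in at_top. measure PH {h. (norm h)\<^sup>2 > \<Delta>} \<le> exp (- (\<Delta> powr \<omega>))"
    using assms by (auto simp: fading_law_def)
  have summ: "summable (\<lambda>n. real (Suc n) ^ 2 * measure PH (?A n))"
  proof (rule summable_comparison_test_ev)
    have "(\<lambda>n::nat. real (Suc n) ^ 2 * exp (- (real n powr \<omega>))) \<in> o(\<lambda>n. 1 / real n ^ 2)"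
      using \<omega> by real_asymp
    then have "\<forall>\<^sub>F n in sequentially. norm (real (Suc n) ^ 2 * exp (- (real n powr \<omega>))) \<le> 1 * norm (1 / real n ^ 2)"
      by (intro landau_o.smallD) simp_all
    moreover have "\<forall>\<^sub>F n in sequentially. measure PH (?A n) \<le> exp (- (real n powr \<omega>))"
      using eventually_compose_filterlim[OF tail filterlim_real_sequentially] by simp
    ultimately show "\<forall>\<^sub>F n in sequentially. norm (real (Suc n) ^ 2 * measure PH (?A n)) \<le> 1 / real n ^ 2"
    proof eventually_elim
      case (elim n)
      have "real (Suc n) ^ 2 * measure PH (?A n) \<le> real (Suc n) ^ 2 * exp (- (real n powr \<omega>))"
        using elim(2) by (intro mult_left_mono) auto
      also have "\<dots> \<le> 1 / real n ^ 2"
        using elim(1) by simp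
      finally show ?case
        by simp
    qed
    show "summable (\<lambda>n. 1 / real n ^ 2)"
      using inverse_power_summable[of 2] by (simp add: inverse_eq_divide)
  qed
  have le: "ennreal (norm h ^ 4) \<le> (\<Sum>n. ennreal (real (Suc n) ^ 2) * indicator (?A n) h)" for h :: "real ^ 'n"
  proof (cases "h = 0")
    case False
    \<comment> \<open>The ceiling minus 1, rather than the floor, gives the strict inequality
      \<open>real n < (norm h)\<^sup>2\<close> that membership in \<open>?A n\<close>
      demands.\<close>
    define n where "n = nat (\<lceil>(norm h)\<^sup>2\<rceil> - 1)"
    have "\<lceil>(norm h)\<^sup>2\<rceil> \<ge> 1"
      using False by (simp add: one_le_ceiling)
    then have "real n = of_int \<lceil>(norm h)\<^sup>2\<rceil> - 1"
      by (simp add: n_def)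
    then have n: "real n < (norm h)\<^sup>2" "(norm h)\<^sup>2 \<le> real (Suc n)"
      using ceiling_correct[of "(norm h)\<^sup>2"] by linarith+
    have "norm h ^ 4 = ((norm h)\<^sup>2)\<^sup>2"
      by simp
    also have "\<dots> \<le> real (Suc n) ^ 2"
      using n by (intro power_mono) auto
    finally have "ennreal (norm h ^ 4) \<le> ennreal (real (Suc n) ^ 2) * indicator (?A n) h"
      using n(1) by (simp add: ennreal_leI)
    also have "\<dots> = (\<Sum>n\<in>{n}. ennreal (real (Suc n) ^ 2) * indicator (?A n) h)"
      by (simp only: sum.insert finite.emptyI empty_iff not_False_eq_True sum.empty add_0_right)
    also have "\<dots> \<le> (\<Sum>n. ennreal (real (Suc n) ^ 2) * indicator (?A n) h)"
      by (rule sum_le_suminf) auto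
    finally show ?thesis .
  qed simp
  have "(\<integral>\<^sup>+h. ennreal (norm h ^ 4) \<partial>PH) \<le>
      (\<integral>\<^sup>+h. (\<Sum>n. ennreal (real (Suc n) ^ 2) * indicator (?A n) h) \<partial>PH)"
    by (intro nn_integral_mono le)
  also have "\<dots> = (\<Sum>n. \<integral>\<^sup>+h. ennreal (real (Suc n) ^ 2) * indicator (?A n) h \<partial>PH)"
    by (intro nn_integral_suminf) measurable
  also have "\<dots> = (\<Sum>n. ennreal (real (Suc n) ^ 2 * measure PH (?A n)))"
    by (subst nn_integral_cmult_indicator) (auto simp: emeasure_eq_measure ennreal_mult')
  also have "\<dots> < \<infinity>"
    using summ by (simp add: ennreal_suminf_neq_top less_top[symmetric])
  finally show ?thesis
    by (intro integrableI_bounded) (simp_all add: less_top)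
qed

text \<open>The squared norm is a sum over coordinates, so only the common second moment of the
  components enters and their dependence is immaterial.\<close>

lemma integral_norm_times_vec:
  fixes v :: "real ^ 'n"
  assumes "fading_law PH PH1"
  shows "has_bochner_integral PH (\<lambda>h. (norm (h * v))\<^sup>2) ((\<integral>t. t\<^sup>2 \<partial>PH1) * (norm v)\<^sup>2)"
proof -
  have [measurable_cong]: "sets PH = sets borel" and PH1: "\<And>j. distr PH borel (\<lambda>h. h $ j) = PH1"
    and int: "integrable PH1 (\<lambda>t. t\<^sup>2)"
    using assms by (simp_all add: fading_law_def)
  have comp: "has_bochner_integral PH (\<lambda>h. (h $ j)\<^sup>2) (\<integral>t. t\<^sup>2 \<partial>PH1)" for j
    using int unfolding PH1[of j, symmetric]
    by (simp add: has_bochner_integral_iff integrable_distr_eq integral_distr)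
  have norm2: "(norm u)\<^sup>2 = (\<Sum>j\<in>UNIV. (u $ j)\<^sup>2)" for u :: "real ^ 'n"
    by (simp add: norm_vec_def L2_set_def sum_nonneg)
  have "has_bochner_integral PH (\<lambda>h. \<Sum>j\<in>UNIV. (h $ j)\<^sup>2 * (v $ j)\<^sup>2)
      (\<Sum>j\<in>UNIV. (\<integral>t. t\<^sup>2 \<partial>PH1) * (v $ j)\<^sup>2)"
    by (intro has_bochner_integral_sum has_bochner_integral_mult_left comp)
  then show ?thesis
    by (simp add: norm2 power_mult_distrib sum_distrib_left)
qed

text \<open>\<open>cond_info_approx\<close> is integrated over the fading: the main term by
  \<open>integral_norm_times_vec\<close>, the error by the fourth moment. The factor
  \<open>log 2 (exp 1)\<close> converts nats to bits, and the energy is divided out because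
  \<open>SNR\<close> contains it.\<close>

theorem has_bicm_coefficient_labeling:
  fixes x :: "nat \<Rightarrow> real ^ 'n" and PH :: "(real ^ 'n) measure"
  assumes L: "labeling m L" and fading: "fading_law PH PH1" and energy: "symbol_energy m x L > 0"
  shows "has_bicm_coefficient m x L PH PH1
    (log 2 (exp 1) * (\<Sum>k<m. (norm (column_sum m x L k))\<^sup>2) / (2 ^ m)\<^sup>2 / symbol_energy m x L)"
    (is "has_bicm_coefficient _ _ _ _ _ ?\<alpha>")
proof -
  have PH: "prob_space PH" "sets PH = sets borel" and E: "(\<integral>t. t\<^sup>2 \<partial>PH1) > 0"
    using fading by (simp_all add: fading_law_def)
  define R where "R = (\<Sum>i<2 ^ m. norm (x i))"
  have R: "norm (x i) \<le> R" if "i < 2 ^ m" for i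
    unfolding R_def using that by (intro member_le_sum) auto
  define \<nu> where "\<nu> k = column_sum m x L k /\<^sub>R 2 ^ m" for k
  define K where "K = 228 * R ^ 4 * (\<integral>h. norm h ^ 4 \<partial>PH)"
  let ?E = "\<integral>t. t\<^sup>2 \<partial>PH1"
  have err: "\<bar>(\<integral>h. cond_info m x L N0 k h \<partial>PH) * ln 2 - ?E * (norm (\<nu> k))\<^sup>2 / N0\<bar> \<le> K / N0\<^sup>2"
    if N0: "N0 > 0" and k: "k < m" for N0 k
  proof -
    note int1 = integrable_cond_info[OF PH N0 k L, of x]
      and int2 = integral_norm_times_vec[OF fading, of "\<nu> k"]
    have "(\<integral>h. cond_info m x L N0 k h \<partial>PH) * ln 2 - ?E * (norm (\<nu> k))\<^sup>2 / N0 =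
        (\<integral>h. cond_info m x L N0 k h * ln 2 - (norm (h * \<nu> k))\<^sup>2 / N0 \<partial>PH)"
      using int1 int2 by (simp add: has_bochner_integral_iff)
    also have "\<bar>\<dots>\<bar> \<le> (\<integral>h. \<bar>cond_info m x L N0 k h * ln 2 - (norm (h * \<nu> k))\<^sup>2 / N0\<bar> \<partial>PH)"
      by (rule integral_abs_bound)
    also have "\<dots> \<le> (\<integral>h. 228 * R ^ 4 / N0\<^sup>2 * norm h ^ 4 \<partial>PH)"
    proof (rule integral_mono)
      show "integrable PH (\<lambda>h. \<bar>cond_info m x L N0 k h * ln 2 - (norm (h * \<nu> k))\<^sup>2 / N0\<bar>)"
        using int1 int2 by (simp add: has_bochner_integral_iff)
      show "integrable PH (\<lambda>h. 228 * R ^ 4 / N0\<^sup>2 * norm h ^ 4)"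
        using integrable_norm_power4[OF fading] by simp
      show "\<bar>cond_info m x L N0 k h * ln 2 - (norm (h * \<nu> k))\<^sup>2 / N0\<bar> \<le> 228 * R ^ 4 / N0\<^sup>2 * norm h ^ 4" for h
        using cond_info_approx[OF N0 k L R, where h = h]
        by (simp add: \<nu>_def power_mult_distrib power_divide mult_ac)
    qed
    also have "\<dots> = K / N0\<^sup>2"
      by (simp add: K_def)
    finally show ?thesis .
  qed
  have "\<bar>bicm_capacity m x L PH N0 - ?\<alpha> * SNR m x L PH1 N0\<bar> \<le>
      m * K / ln 2 / (?E * symbol_energy m x L)\<^sup>2 * \<bar>(SNR m x L PH1 N0)\<^sup>2\<bar>" if N0: "N0 > 0" for N0
  proof -
    have "bicm_capacity m x L PH N0 = (\<Sum>k<m. \<integral>h. cond_info m x L N0 k h \<partial>PH)"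
      unfolding bicm_capacity_def
      by (intro sum.cong) (simp_all add: integral_information_density[OF PH N0 _ L])
    moreover have "?\<alpha> * SNR m x L PH1 N0 = (\<Sum>k<m. ?E * (norm (\<nu> k))\<^sup>2 / N0 / ln 2)"
    proof -
      have "?\<alpha> * SNR m x L PH1 N0 = (\<Sum>k<m. (norm (column_sum m x L k))\<^sup>2) * (?E / (2 ^ m)\<^sup>2 / N0 / ln 2)"
        using energy by (simp add: SNR_def log_def)
      also have "\<dots> = (\<Sum>k<m. ?E * (norm (\<nu> k))\<^sup>2 / N0 / ln 2)"
        unfolding sum_distrib_right
        by (simp add: \<nu>_def power_mult_distrib power_inverse divide_inverse mult_ac)
      finally show ?thesis .
    qed
    ultimately have "(bicm_capacity m x L PH N0 - ?\<alpha> * SNR m x L PH1 N0) * ln 2 =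
        (\<Sum>k<m. (\<integral>h. cond_info m x L N0 k h \<partial>PH) * ln 2 - ?E * (norm (\<nu> k))\<^sup>2 / N0)"
      by (simp add: sum_subtractf sum_distrib_right left_diff_distrib)
    also have "\<bar>\<dots>\<bar> \<le> (\<Sum>k<m. K / N0\<^sup>2)"
      by (intro order_trans[OF sum_abs] sum_mono err[OF N0]) simp
    finally have "\<bar>bicm_capacity m x L PH N0 - ?\<alpha> * SNR m x L PH1 N0\<bar> * ln 2 \<le> m * (K / N0\<^sup>2)"
      by (simp add: abs_mult)
    then have "\<bar>bicm_capacity m x L PH N0 - ?\<alpha> * SNR m x L PH1 N0\<bar> \<le> m * (K / N0\<^sup>2) / ln 2"
      by (intro pos_le_divide_eq[THEN iffD2]) simp_all
    \<comment> \<open>\<open>SNR\<close> is a positive constant divided by \<open>N0\<close>, so an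
      error of order \<open>1 / N0\<^sup>2\<close> is one of order \<open>SNR\<close>
      squared.\<close>
    also have "\<dots> = m * K / ln 2 / (?E * symbol_energy m x L)\<^sup>2 * \<bar>(SNR m x L PH1 N0)\<^sup>2\<bar>"
      using E energy by (simp add: SNR_def power_divide)
    finally show ?thesis .
  qed
  then show ?thesis
    unfolding has_bicm_coefficient_def
    by (intro bigoI[of _ "m * K / ln 2 / (?E * symbol_energy m x L)\<^sup>2"]
        eventually_mono[OF eventually_gt_at_top[of 0]]) simp
qed

lemma has_bicm_coefficient_psk:
  assumes "labeling m L" "fading_law PH PH1"
    and "(\<Sum>k<m. (norm (column_sum m (psk (2 ^ m)) L k))\<^sup>2) = S"
  shows "has_bicm_coefficient m (psk (2 ^ m)) L PH PH1 (log 2 (exp 1) * S / (2 ^ m)\<^sup>2)"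
  using has_bicm_coefficient_labeling[OF assms(1,2), of "psk (2 ^ m)"] assms(3)
  by (simp add: symbol_energy_psk)

text \<open>The Gray clause starts at order 2: by \<open>BRGC_1_eq_NBC_1\<close> the codes agree at
  order 1, where the natural binary clause gives the coefficient with 4 in place of 8.\<close>

theorem theorem21:
  fixes m M :: nat and PH :: "(real ^ 2) measure" and PH1 :: "real measure"
  assumes "M = 2 ^ m"
    and "fading_law PH PH1"
  shows
    "(m \<ge> 2 \<longrightarrow> has_bicm_coefficient m (psk M) (BRGC m) PH PH1
        (8 * log 2 (exp 1) / (real M ^ 2 * sin (pi / M) ^ 2))) \<and>
     (m \<ge> 1 \<longrightarrow> has_bicm_coefficient m (psk M) (NBC m) PH PH1
        (4 * log 2 (exp 1) / (real M ^ 2 * sin (pi / M) ^ 2))) \<and>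
     (m \<ge> 3 \<longrightarrow> has_bicm_coefficient m (psk M) (BSGC m) PH PH1
        (4 * log 2 (exp 1) / (real M ^ 2 * sin (pi / M) ^ 2)
          * (1 + (1 - 1 / cos (2 * pi / M)) ^ 2))) \<and>
     (m \<ge> 2 \<longrightarrow> has_bicm_coefficient m (psk M) (FBC m) PH PH1
        (4 * log 2 (exp 1) / (real M ^ 2 * sin (pi / M) ^ 2)
          * (1 + (\<Sum>k=2..m. tan (pi / 2 ^ k) ^ 2))))"
proof -
  note coeff = has_bicm_coefficient_psk[OF _ assms(2)]
  show ?thesis
    using coeff[OF labeling_BRGC column_sums_BRGC] coeff[OF labeling_NBC column_sums_NBC]
      coeff[OF labeling_BSGC column_sums_BSGC] coeff[OF labeling_FBC column_sums_FBC]
    by (simp add: assms(1) mult_ac)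
qed

end
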